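(* Let $b$ be a fixed prime, $m,s\in\mathbb{N}$, $N=b^m$, $\alpha>1$, let $\gamma_1,\ldots,\gamma_s>0$ be product weights, and let $w_1\le\cdots\le w_s$ be non-negative integers. Let $s^\ast$ be the largest integer $j$ such that $w_j<m$. Then the cost (number of arithmetic operations) of the reduced fast CBC algorithm for polynomial lattice rules with modulus $x^m$ over $\mathbb{F}_b$ described in the context is of order $$O\left(b^m+\min\{s,s^\ast\}\,b^m+\sum_{d=1}^{\min\{s,s^\ast\}}(m-w_d)^2\,b^{m-w_d}\right).$$
   Context: $\mathbb{F}_b$ is the field with $b$ elements. A non-negative integer $n=n_0+n_1b+\cdots+n_rb^r$ with digits $n_i\in\{0,\ldots,b-1\}$ is identified with the polynomial $n_0+n_1x+\cdots+n_rx^r\in\mathbb{F}_b[x]$; arithmetic is polynomial arithmetic. For $f=a_0+a_1x+\cdots\in\mathbb{F}_b[x]$ and $k\ge1$, $\nu\left(\frac{f}{x^k}\right)=\frac{a_{k-1}}{b}+\cdots+\frac{a_0}{b^k}\in[0,1)$ (coefficients $a_i$ with $i\ge k$ are ignored; missing coefficients are $0$). The algorithm constructs a generating vector $\boldsymbol{g}=(Y_1g_1,\ldots,Y_sg_s)$, $Y_j=x^{w_j}$, of the polynomial lattice point set with points $\left(\nu\left(\frac{nY_1g_1}{x^m}\right),\ldots,\nu\left(\frac{nY_sg_s}{x^m}\right)\right)$, $n\in\mathbb{F}_b[x]$, $\deg n<m$, for integration in the weighted Walsh space with smoothness $\alpha$ and product weights $\gamma_{\mathfrak{u}}=\prod_{j\in\mathfrak{u}}\gamma_j$,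 i.e. the reproducing kernel Hilbert space on $[0,1)^s$ with kernel $\prod_{j=1}^s\left(1+\gamma_j\sum_{h\ge1}b^{-\alpha\lfloor\log_bh\rfloor}\mathrm{wal}_h(x_j)\overline{\mathrm{wal}_h(y_j)}\right)$, where $\mathrm{wal}_h$ is the $h$th Walsh function in base $b$. The squared worst-case error of the rule generated by $(Y_1g_1,\ldots,Y_dg_d)$ is $-1+\frac1N\sum_{n=0}^{N-1}\prod_{j=1}^d\left[1+\gamma_j\varphi_\alpha\left(\nu\left(\frac{nY_jg_j}{x^m}\right)\right)\right]$ with $\varphi_\alpha(y)=\sum_{h\ge1}b^{-\alpha\lfloor\log_bh\rfloor}\mathrm{wal}_h(y)$; it is known that all $N=b^m$ values $\varphi_\alpha(\nu(f/x^m))$, $\deg f<m$, can be computed in $O(N)$ operations. For $k\ge1$ let $\mathcal{Z}_{b^k,0}=\{g\in\mathbb{F}_b[x]:\deg g<k,\ g(0)\ne0\}$ and let $\Omega^{(k)}=\left(\varphi_\alpha\left(\nu\left(\frac{ng}{x^k}\right)\right)\right)_{g\in\mathcal{Z}_{b^k,0},\,n\in\mathbb{F}_b[x],\,\deg n<k}$. Reduced fast CBC algorithm for polynomial lattice rules. Pre-computation: compute and store $\varphi_\alpha(\nu(f/x^m))$ for all $f$ with $\deg f<m$; set $g_1=1$ and $\eta_1(n)=1+\gamma_1\varphi_\alpha(\nu(nY_1g_1/x^m))$ for $n=0,\ldots,b^m-1$; let $s^\ast$ be the largest integer $j$ with $w_j<m$ ($s^\ast=0$ if there is none). For $d=2,\ldots,\min\{s,s^\ast\}$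 successively: (1) partition $\eta_{d-1}=(\eta_{d-1}(n))_{n=0}^{b^m-1}$ into $b^{w_d}$ consecutive vectors of length $b^{m-w_d}$ and let $\eta'$ be their sum; (2) compute $T_d=\Omega^{(m-w_d)}\eta'$, so that $T_d(g)=\sum_{n=0}^{b^m-1}\varphi_\alpha\left(\nu\left(\frac{nY_dg}{x^m}\right)\right)\eta_{d-1}(n)$ for $g\in\mathcal{Z}_{b^{m-w_d},0}$; the matrix-vector product is computed by the FFT-based method of Nuyens and Cools, using a decomposition of the group of units of $\mathbb{F}_b[x]/(x^k)$ ($k=m-w_d$) as a direct product of cyclic groups; (3) let $g_d=\mathrm{argmin}_gT_d(g)$; (4) let $\eta_d(n)=\eta_{d-1}(n)\left(1+\gamma_d\varphi_\alpha(\nu(nY_dg_d/x^m))\right)$ for $n=0,\ldots,b^m-1$. Components with index $j>s^\ast$ satisfy $Y_j\equiv0\pmod{x^m}$ and are fixed (for example $g_j=1$) without any computation; they are not counted in the cost, nor is the evaluation of the final worst-case error. The implied constant in $O$ may depend on the fixed $b$ and $\alpha$, but not on $m$, $s$, the $w_j$ or the $\gamma_j$. *)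

theory Defs
  imports
    Complex_Main
    "HOL-Library.Monad_Syntax"
    "HOL-Library.FuncSet"
    "HOL-Number_Theory.Cong"
    "Berlekamp_Zassenhaus.Finite_Field"
begin

text \<open>
  The prime \<open>b\<close> is \<open>CARD('p)\<close> for a type \<open>'p\<close> of class \<^class>\<open>prime_card\<close>, and
  \<open>'p mod_ring\<close> is the field with \<open>b\<close> elements.  A number \<open>n < b ^ m\<close> is identified with the
  polynomial whose coefficients are its base-\<open>b\<close> digits, so a vector of length \<open>b ^ m\<close> is an
  array indexed by \<open>polys_below m\<close>.
\<close>

abbreviation X_pow :: "nat \<Rightarrow> 'p::prime_card mod_ring poly" where
  "X_pow k \<equiv> monom 1 k"

definition polys_below :: "nat \<Rightarrow> 'p::prime_card mod_ring poly set" where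
  "polys_below k = {f. f = 0 \<or> degree f < k}"

definition unit_polys :: "nat \<Rightarrow> 'p::prime_card mod_ring poly set" where
  "unit_polys k = {g \<in> polys_below k. coeff g 0 \<noteq> 0}"

definition nu :: "nat \<Rightarrow> 'p::prime_card mod_ring poly \<Rightarrow> real" where
  "nu k f = (\<Sum>i<k. real_of_int (to_int_mod_ring (coeff f i)) / real CARD('p) ^ (k - i))"

definition wal :: "nat \<Rightarrow> nat \<Rightarrow> real \<Rightarrow> complex" where
  "wal b h x = cis (2 * pi / real b *
     (\<Sum>i | b ^ i \<le> h. real (h div b ^ i mod b) * real_of_int (\<lfloor>x * real b ^ Suc i\<rfloor> mod int b)))"

definition walsh_phi :: "nat \<Rightarrow> real \<Rightarrow> real \<Rightarrow> complex" where
  "walsh_phi b \<alpha> y =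
     (\<Sum>i. complex_of_real (real b powr (- \<alpha> * \<lfloor>log (real b) (real (Suc i))\<rfloor>)) * wal b (Suc i) y)"

definition Omega ::
  "real \<Rightarrow> nat \<Rightarrow> 'p::prime_card mod_ring poly \<Rightarrow> 'p mod_ring poly \<Rightarrow> complex" where
  "Omega \<alpha> k g n = walsh_phi CARD('p) \<alpha> (nu k (n * g))"


text \<open>
  A value of type \<open>'a counted\<close> is the result of a computation together with the number of
  operations it used.  One operation is: an arithmetic operation on real or complex numbers
  (including a real power and the evaluation of a root of unity), a comparison of two reals, or a
  multiplication in \<open>F_b[x]/(x^k)\<close>.  Reading and writing memory and relabelling digits (the shift
  \<open>f \<mapsto> x^w f\<close>, truncation modulo \<open>x^k\<close>, concatenation \<open>r + x^k t\<close> of digit strings,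
  reading off the degree, looking up the exponents of a stored group element) and integer
  arithmetic on array indices and loop counters are not arithmetic operations and are free, as are the embedding of the reals into the complex numbers
  and the real part.
\<close>

datatype 'a counted = Counted (val: 'a) (ops: nat)

definition return_c :: "'a \<Rightarrow> 'a counted" where
  "return_c x = Counted x 0"

definition bind_c :: "'a counted \<Rightarrow> ('a \<Rightarrow> 'b counted) \<Rightarrow> 'b counted" where
  "bind_c c f = Counted (val (f (val c))) (ops c + ops (f (val c)))"

adhoc_overloading Monad_Syntax.bind \<rightleftharpoons> bind_c

definition add_c :: "'a::plus \<Rightarrow> 'a \<Rightarrow> 'a counted" where
  "add_c x y = Counted (x + y) 1"

definition sub_c :: "'a::minus \<Rightarrow> 'a \<Rightarrow> 'a counted" where
  "sub_c x y = Counted (x - y) 1"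

definition mul_c :: "'a::times \<Rightarrow> 'a \<Rightarrow> 'a counted" where
  "mul_c x y = Counted (x * y) 1"

definition div_c :: "'a::divide \<Rightarrow> 'a \<Rightarrow> 'a counted" where
  "div_c x y = Counted (x div y) 1"

definition powr_c :: "real \<Rightarrow> real \<Rightarrow> real counted" where
  "powr_c x y = Counted (x powr y) 1"

definition root_of_unity_c :: "int \<Rightarrow> nat \<Rightarrow> nat \<Rightarrow> complex counted" where
  "root_of_unity_c \<sigma> n j = Counted (cis (of_int \<sigma> * (2 * pi * real j / real n))) 1"

definition mulmod_c ::
  "nat \<Rightarrow> 'p::prime_card mod_ring poly \<Rightarrow> 'p mod_ring poly \<Rightarrow> 'p mod_ring poly counted" where
  "mulmod_c k f g = Counted (f * g mod X_pow k) 1"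

definition tabulate_c :: "'i set \<Rightarrow> ('i \<Rightarrow> 'a counted) \<Rightarrow> ('i \<Rightarrow> 'a) counted" where
  "tabulate_c A f = Counted (\<lambda>i\<in>A. val (f i)) (\<Sum>i\<in>A. ops (f i))"

definition sum_c :: "'i set \<Rightarrow> ('i \<Rightarrow> 'a::comm_monoid_add counted) \<Rightarrow> 'a counted" where
  "sum_c A f = Counted (\<Sum>i\<in>A. val (f i)) ((\<Sum>i\<in>A. ops (f i)) + (card A - 1))"

definition argmin_c :: "'i set \<Rightarrow> ('i \<Rightarrow> real) \<Rightarrow> 'i counted" where
  "argmin_c A f = Counted (arg_min_on f A) (card A - 1)"

primrec powers_c :: "('a \<Rightarrow> 'a \<Rightarrow> 'a counted) \<Rightarrow> 'a \<Rightarrow> 'a \<Rightarrow> nat \<Rightarrow> (nat \<Rightarrow> 'a) counted" where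
  "powers_c M e x 0 = return_c (\<lambda>i\<in>{0}. e)"
| "powers_c M e x (Suc n) = do {
     P \<leftarrow> powers_c M e x n;
     y \<leftarrow> M (P n) x;
     return_c (P(Suc n := y))
   }"


text \<open>
  If \<open>deg f < m\<close>, then \<open>walsh_phi\<close> at \<open>nu m f\<close> only depends on \<open>deg f\<close>: with
  \<open>q = b^(1-\<alpha>)\<close> and \<open>\<mu> = (b-1)/(1-q)\<close> it equals \<open>\<mu>\<close> for \<open>f = 0\<close> and
  \<open>\<mu> - (\<mu>+1) q^(m-1-deg f)\<close> otherwise (lemma \<open>phi_table_correct\<close> below).
\<close>

definition phi_table_c ::
  "real \<Rightarrow> nat \<Rightarrow> ('p::prime_card mod_ring poly \<Rightarrow> real) counted" where
  "phi_table_c \<alpha> m = do {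
     e \<leftarrow> sub_c 1 \<alpha>;
     q \<leftarrow> powr_c (real CARD('p)) e;
     u \<leftarrow> sub_c (real CARD('p)) 1;
     v \<leftarrow> sub_c 1 q;
     \<mu> \<leftarrow> div_c u v;
     \<mu>' \<leftarrow> add_c \<mu> 1;
     Q \<leftarrow> powers_c mul_c 1 q m;
     tabulate_c (polys_below m) (\<lambda>f.
       if f = 0 then return_c \<mu>
       else do { y \<leftarrow> mul_c \<mu>' (Q (m - 1 - degree f)); sub_c \<mu> y })
   }"


text \<open>
  Mixed-radix Cooley-Tukey transform of length \<open>n\<close> with kernel \<open>exp (\<sigma> 2 \<pi> i j l / n)\<close>,
  \<open>\<sigma> = 1\<close> or \<open>\<sigma> = -1\<close>, splitting off the smallest prime factor \<open>p\<close> of the length.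
\<close>

function fft_c :: "int \<Rightarrow> nat \<Rightarrow> (nat \<Rightarrow> complex) \<Rightarrow> (nat \<Rightarrow> complex) counted" where
  "fft_c \<sigma> n a =
     (if n \<le> 1 then return_c a
      else let p = (LEAST p. prime p \<and> p dvd n); l = n div p in do {
        A \<leftarrow> tabulate_c {..<p} (\<lambda>r. fft_c \<sigma> l (\<lambda>i. a (p * i + r)));
        W \<leftarrow> tabulate_c {..<n} (root_of_unity_c \<sigma> n);
        tabulate_c {..<n} (\<lambda>j. sum_c {..<p} (\<lambda>r. mul_c (W (r * j mod n)) (A r (j mod l))))
      })"
  by auto

lemma least_prime_factor:
  assumes "(1::nat) < n"
  shows "prime (LEAST p. prime p \<and> p dvd n)" "(LEAST p. prime p \<and> p dvd n) dvd n"
proof -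
  obtain p where "prime p \<and> p dvd n"
    using assms prime_factor_nat[of n] by auto
  from LeastI[of "\<lambda>p. prime p \<and> p dvd n", OF this]
  show "prime (LEAST p. prime p \<and> p dvd n)" "(LEAST p. prime p \<and> p dvd n) dvd n" by auto
qed

termination fft_c
proof (relation "measure (\<lambda>(\<sigma>, n, a). n)", goal_cases)
  case (2 \<sigma> n a p l r)
  then show ?case
    using least_prime_factor(1)[of n] prime_gt_1_nat by (auto intro!: div_less_dividend)
qed auto

declare fft_c.simps [simp del]

definition box :: "nat list \<Rightarrow> nat list set" where
  "box ns = listset (map lessThan ns)"

fun multi_fft_c ::
  "int \<Rightarrow> nat list \<Rightarrow> (nat list \<Rightarrow> complex) \<Rightarrow> (nat list \<Rightarrow> complex) counted" where
  "multi_fft_c \<sigma> [] a = return_c a"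
| "multi_fft_c \<sigma> (n # ns) a = do {
     B \<leftarrow> tabulate_c {..<n} (\<lambda>i. multi_fft_c \<sigma> ns (\<lambda>e. a (i # e)));
     C \<leftarrow> tabulate_c (box ns) (\<lambda>e. fft_c \<sigma> n (\<lambda>i. B i e));
     return_c (\<lambda>e\<in>box (n # ns). C (tl e) (hd e))
   }"


text \<open>
  \<open>[(g_1, n_1), \<dots>, (g_r, n_r)]\<close> describes the group of units of \<open>F_b[x]/(x^k)\<close> as the direct
  product of the non-trivial cyclic subgroups of order \<open>n_i\<close> generated by \<open>g_i\<close>.
\<close>

definition power_product ::
  "('p::prime_card mod_ring poly \<times> nat) list \<Rightarrow> nat list \<Rightarrow> 'p mod_ring poly" where
  "power_product D e = prod_list (map2 (\<lambda>(g, n) i. g ^ i) D e)"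

definition unit_group_decomposition ::
  "nat \<Rightarrow> ('p::prime_card mod_ring poly \<times> nat) list \<Rightarrow> bool" where
  "unit_group_decomposition k D \<longleftrightarrow>
     (\<forall>(g, n) \<in> set D. g \<in> unit_polys k \<and> n \<ge> 2 \<and> [g ^ n = 1] (mod X_pow k)) \<and>
     bij_betw (\<lambda>e. power_product D e mod X_pow k) (box (map snd D)) (unit_polys k)"

fun group_table_c ::
  "nat \<Rightarrow> ('p::prime_card mod_ring poly \<times> nat) list \<Rightarrow> (nat list \<Rightarrow> 'p mod_ring poly) counted" where
  "group_table_c k [] = return_c (\<lambda>e\<in>box []. 1)"
| "group_table_c k ((g, n) # D) = do {
     P \<leftarrow> powers_c (mulmod_c k) 1 g n;
     R \<leftarrow> group_table_c k D;
     tabulate_c (box (n # map snd D)) (\<lambda>e. mulmod_c k (P (hd e)) (R (tl e)))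
   }"

text \<open>
  The correlation \<open>T(g) = \<Sum>n. c(n g) a(n)\<close>, where \<open>g\<close> and \<open>n\<close> range over the group of units:
  in exponents its Fourier transform is the product of the forward transform of \<open>c\<close> and the
  backward transform of \<open>a\<close>.
\<close>

definition correlation_c ::
  "nat \<Rightarrow> ('p::prime_card mod_ring poly \<times> nat) list \<Rightarrow> ('p mod_ring poly \<Rightarrow> real) \<Rightarrow>
   ('p mod_ring poly \<Rightarrow> real) \<Rightarrow> ('p mod_ring poly \<Rightarrow> real) counted" where
  "correlation_c k D c a = (let ns = map snd D in do {
     R \<leftarrow> group_table_c k D;
     C \<leftarrow> multi_fft_c 1 ns (\<lambda>e. complex_of_real (c (R e)));
     A \<leftarrow> multi_fft_c (-1) ns (\<lambda>e. complex_of_real (a (R e)));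
     P \<leftarrow> tabulate_c (box ns) (\<lambda>e. mul_c (C e) (A e));
     T \<leftarrow> multi_fft_c (-1) ns P;
     S \<leftarrow> tabulate_c (box ns) (\<lambda>e. div_c (T e) (of_nat (prod_list ns)));
     return_c (\<lambda>g\<in>unit_polys k. Re (S (inv_into (box ns) R g)))
   })"

text \<open>
  The product of the matrix \<open>\<Omega>\<close> at level \<open>k\<close> with a vector \<open>a\<close>.  Every non-zero \<open>n\<close> of degree
  below \<open>k\<close> is uniquely \<open>x^(k-j) n'\<close> with \<open>n' \<in> unit_polys j\<close>, \<open>1 \<le> j \<le> k\<close>, and
  \<open>\<nu>(n g / x^k) = \<nu>(n' g / x^j)\<close> only depends on \<open>g\<close> modulo \<open>x^j\<close>; so the columns split into
  \<open>k\<close> blocks, each a (repeated) group correlation, and the column \<open>n = 0\<close>.  The argument \<open>tab\<close> is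
  the table of kernel values for the modulus \<open>x^m\<close>, and \<open>\<nu>(f / x^j) = \<nu>(x^(m-j) f / x^m)\<close>.
\<close>

definition fast_matvec_c ::
  "('p::prime_card mod_ring poly \<Rightarrow> real) \<Rightarrow> nat \<Rightarrow> (nat \<Rightarrow> ('p mod_ring poly \<times> nat) list) \<Rightarrow>
   nat \<Rightarrow> ('p mod_ring poly \<Rightarrow> real) \<Rightarrow> ('p mod_ring poly \<Rightarrow> real) counted" where
  "fast_matvec_c tab m D k a = do {
     B \<leftarrow> tabulate_c {1..k} (\<lambda>j.
            correlation_c j (D j) (\<lambda>f. tab (X_pow (m - j) * f)) (\<lambda>f. a (X_pow (k - j) * f)));
     z \<leftarrow> mul_c (tab 0) (a 0);
     tabulate_c (unit_polys k) (\<lambda>g. do {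
       t \<leftarrow> sum_c {1..k} (\<lambda>j. return_c (B j (g mod X_pow j)));
       add_c z t
     })
   }"


definition factor_c ::
  "('p::prime_card mod_ring poly \<Rightarrow> real) \<Rightarrow> nat \<Rightarrow> nat \<Rightarrow> real \<Rightarrow> 'p mod_ring poly \<Rightarrow>
   'p mod_ring poly \<Rightarrow> real counted" where
  "factor_c tab m w \<gamma> g n = do {
     f \<leftarrow> mulmod_c m n (X_pow w * g);
     y \<leftarrow> mul_c \<gamma> (tab f);
     add_c 1 y
   }"

definition cbc_step_c ::
  "('p::prime_card mod_ring poly \<Rightarrow> real) \<Rightarrow> nat \<Rightarrow> nat \<Rightarrow> real \<Rightarrow>
   (nat \<Rightarrow> ('p mod_ring poly \<times> nat) list) \<Rightarrow> ('p mod_ring poly \<Rightarrow> real) \<Rightarrow>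
   ('p mod_ring poly \<times> ('p mod_ring poly \<Rightarrow> real)) counted" where
  "cbc_step_c tab m w \<gamma> D \<eta> = do {
     \<eta>' \<leftarrow> tabulate_c (polys_below (m - w)) (\<lambda>r.
             sum_c (polys_below w) (\<lambda>t. return_c (\<eta> (r + X_pow (m - w) * t))));
     T \<leftarrow> fast_matvec_c tab m D (m - w) \<eta>';
     g \<leftarrow> argmin_c (unit_polys (m - w)) T;
     \<eta>'' \<leftarrow> tabulate_c (polys_below m) (\<lambda>n. do {
              y \<leftarrow> factor_c tab m w \<gamma> g n;
              mul_c (\<eta> n) y
            });
     return_c (g, \<eta>'')
   }"

text \<open>State after component \<open>Suc r\<close>: the vector of the \<open>g_j\<close> and the array \<open>\<eta>\<close> for this component.\<close>

primrec cbc_loop_c ::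
  "('p::prime_card mod_ring poly \<Rightarrow> real) \<Rightarrow> nat \<Rightarrow> (nat \<Rightarrow> nat) \<Rightarrow> (nat \<Rightarrow> real) \<Rightarrow>
   (nat \<Rightarrow> ('p mod_ring poly \<times> nat) list) \<Rightarrow> nat \<Rightarrow>
   ((nat \<Rightarrow> 'p mod_ring poly) \<times> ('p mod_ring poly \<Rightarrow> real)) counted" where
  "cbc_loop_c tab m w \<gamma> D 0 = do {
     \<eta> \<leftarrow> tabulate_c (polys_below m) (factor_c tab m (w 1) (\<gamma> 1) 1);
     return_c (\<lambda>_. 1, \<eta>)
   }"
| "cbc_loop_c tab m w \<gamma> D (Suc r) = do {
     (g, \<eta>) \<leftarrow> cbc_loop_c tab m w \<gamma> D r;
     (g', \<eta>') \<leftarrow> cbc_step_c tab m (w (r + 2)) (\<gamma> (r + 2)) D \<eta>;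
     return_c (g(r + 2 := g'), \<eta>')
   }"

definition s_star :: "nat \<Rightarrow> nat \<Rightarrow> (nat \<Rightarrow> nat) \<Rightarrow> nat" where
  "s_star m s w = Max (insert 0 {j \<in> {1..s}. w j < m})"

definition reduced_fast_cbc ::
  "real \<Rightarrow> nat \<Rightarrow> nat \<Rightarrow> (nat \<Rightarrow> nat) \<Rightarrow> (nat \<Rightarrow> real) \<Rightarrow>
   (nat \<Rightarrow> ('p::prime_card mod_ring poly \<times> nat) list) \<Rightarrow> (nat \<Rightarrow> 'p mod_ring poly) counted" where
  "reduced_fast_cbc \<alpha> m s w \<gamma> D = do {
     tab \<leftarrow> phi_table_c \<alpha> m;
     (g, \<eta>) \<leftarrow> cbc_loop_c tab m w \<gamma> D (min s (s_star m s w) - 1);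
     return_c g
   }"

lemma val_ops_simps [simp]:
  "val (return_c x) = x" "ops (return_c x) = 0"
  "val (bind_c c f) = val (f (val c))" "ops (bind_c c f) = ops c + ops (f (val c))"
  "val (tabulate_c A h) = (\<lambda>i\<in>A. val (h i))" "val (sum_c A s) = (\<Sum>i\<in>A. val (s i))"
  by (simp_all add: return_c_def bind_c_def tabulate_c_def sum_c_def)

lemma val_op_simps [simp]:
  "val (add_c x1 y1) = x1 + y1" "val (sub_c x2 y2) = x2 - y2" "val (mul_c x3 y3) = x3 * y3"
  "val (div_c x4 y4) = x4 div y4" "val (powr_c x5 y5) = x5 powr y5"
  "val (mulmod_c k f g) = f * g mod X_pow k" "val (argmin_c A h) = arg_min_on h A"
  by (simp_all add: add_c_def sub_c_def mul_c_def div_c_def powr_c_def mulmod_c_def argmin_c_def)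

definition unity :: "int \<Rightarrow> nat \<Rightarrow> nat \<Rightarrow> complex" where
  "unity \<sigma> n j = cis (of_int \<sigma> * (2 * pi * real j / real n))"

lemma val_root_of_unity_c [simp]: "val (root_of_unity_c \<sigma> n j) = unity \<sigma> n j"
  by (simp add: root_of_unity_c_def unity_def)

lemma unity_0 [simp]: "unity \<sigma> n 0 = 1"
  by (simp add: unity_def)

lemma unity_add: "unity \<sigma> n (i + j) = unity \<sigma> n i * unity \<sigma> n j"
  by (simp add: unity_def cis_mult algebra_simps add_divide_distrib)

lemma unity_mult_self: assumes "n > 0" shows "unity \<sigma> n (n * i) = 1"
proof -
  have "of_int \<sigma> * (2 * pi * real (n * i) / real n) = 2 * pi * of_int (\<sigma> * int i)"
    using assms by simp
  then show ?thesis unfolding unity_def by (metis cis_multiple_2pi Ints_of_int)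
qed

lemma unity_mod: assumes "n > 0" shows "unity \<sigma> n (j mod n) = unity \<sigma> n j"
proof -
  have "unity \<sigma> n j = unity \<sigma> n (n * (j div n) + j mod n)" by simp
  also have "\<dots> = unity \<sigma> n (j mod n)"
    by (simp only: unity_add unity_mult_self[OF assms] mult_1)
  finally show ?thesis by simp
qed

lemma unity_cong: assumes "n > 0" "i mod n = j mod n" shows "unity \<sigma> n i = unity \<sigma> n j"
  using unity_mod[OF assms(1), of \<sigma> i] unity_mod[OF assms(1), of \<sigma> j] assms(2) by simp

lemma unity_scale: assumes "p > 0" shows "unity \<sigma> (p * l) (p * i) = unity \<sigma> l i"
  using assms by (simp add: unity_def mult.left_commute[of _ "real p"] mult.assoc)

lemma sum_residue_split:
  fixes f :: "nat \<Rightarrow> complex"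
  assumes "p > 0"
  shows "(\<Sum>r<p. \<Sum>i<l. f (p * i + r)) = (\<Sum>i<p * l. f i)"
proof -
  have "(\<Sum>r<p. \<Sum>i<l. f (p * i + r)) = (\<Sum>(r, i)\<in>{..<p} \<times> {..<l}. f (p * i + r))"
    by (simp add: sum.cartesian_product)
  also have "\<dots> = (\<Sum>i<p * l. f i)"
  proof (rule sum.reindex_bij_witness[of _ "\<lambda>i. (i mod p, i div p)" "\<lambda>(r, i). p * i + r"])
    fix i assume "i \<in> {..<p * l}"
    then show "(i mod p, i div p) \<in> {..<p} \<times> {..<l}"
      using assms by (auto simp: less_mult_imp_div_less mult.commute)
  next
    fix x assume "x \<in> {..<p} \<times> {..<l}"
    then obtain r i where x: "x = (r, i)" "r < p" "i < l" by auto
    have "p * i + r < p * (i + 1)" using x by simp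
    also have "\<dots> \<le> p * l" using x by (intro mult_le_mono2) simp
    finally show "(case x of (r, i) \<Rightarrow> p * i + r) \<in> {..<p * l}" using x by simp
  qed auto
  finally show ?thesis .
qed

lemma fft_c_correct:
  "j < n \<Longrightarrow> val (fft_c \<sigma> n a) j = (\<Sum>i<n. a i * unity \<sigma> n (i * j))"
proof (induction \<sigma> n a arbitrary: j rule: fft_c.induct)
  case (1 \<sigma> n a)
  show ?case
  proof (cases "n \<le> 1")
    case True
    with 1(2) have "n = 1" "j = 0" by auto
    then show ?thesis by (simp add: fft_c.simps)
  next
    case False
    define p where "p = (LEAST p. prime p \<and> p dvd n)"
    define l where "l = n div p"
    have p: "prime p" "p dvd n" using least_prime_factor[of n] False by (auto simp: p_def)
    then have p0: "p > 0" and n: "n = p * l" by (auto simp: l_def prime_gt_0_nat)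
    then have l0: "l > 0" using False by (cases l) auto
    have jl: "j mod l < l" using l0 by simp
    have IH: "val (fft_c \<sigma> l (\<lambda>i. a (p * i + r))) (j mod l) =
        (\<Sum>i<l. a (p * i + r) * unity \<sigma> l (i * (j mod l)))" for r
      using 1(1)[OF False p_def l_def jl] .
    have "val (fft_c \<sigma> n a) j =
        (\<Sum>r<p. unity \<sigma> n (r * j mod n) * (\<Sum>i<l. a (p * i + r) * unity \<sigma> l (i * (j mod l))))"
      using False 1(2) by (subst fft_c.simps) (simp add: Let_def p_def[symmetric] l_def[symmetric] IH)
    also have "\<dots> = (\<Sum>r<p. \<Sum>i<l. a (p * i + r) * unity \<sigma> n ((p * i + r) * j))"
    proof (intro sum.cong refl)
      fix r
      have "unity \<sigma> n (r * j mod n) * (a (p * i + r) * unity \<sigma> l (i * (j mod l))) =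
          a (p * i + r) * unity \<sigma> n ((p * i + r) * j)" for i
      proof -
        have "unity \<sigma> l (i * (j mod l)) = unity \<sigma> l (i * j)"
          by (rule unity_cong[OF l0]) (simp add: mod_mult_right_eq)
        also have "\<dots> = unity \<sigma> n (p * (i * j))"
          unfolding n using unity_scale[OF p0] by simp
        finally have *: "unity \<sigma> l (i * (j mod l)) = unity \<sigma> n (p * (i * j))" .
        have **: "unity \<sigma> n (r * j mod n) = unity \<sigma> n (r * j)"
          using False by (intro unity_mod) simp
        have "unity \<sigma> n ((p * i + r) * j) = unity \<sigma> n (p * (i * j)) * unity \<sigma> n (r * j)"
          by (simp add: unity_add[symmetric] algebra_simps)
        then show ?thesis unfolding * ** by simp
      qed
      then show "unity \<sigma> n (r * j mod n) * (\<Sum>i<l. a (p * i + r) * unity \<sigma> l (i * (j mod l))) =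
          (\<Sum>i<l. a (p * i + r) * unity \<sigma> n ((p * i + r) * j))"
        by (simp only: sum_distrib_left)
    qed
    also have "\<dots> = (\<Sum>i<n. a i * unity \<sigma> n (i * j))"
      unfolding n by (rule sum_residue_split[OF p0, of "\<lambda>i. a i * unity \<sigma> (p * l) (i * j)"])
    finally show ?thesis .
  qed
qed

lemma box_Nil [simp]: "box [] = {[]}"
  by (simp add: box_def)

lemma box_Cons: "box (n # ns) = (\<lambda>(i, e). i # e) ` ({..<n} \<times> box ns)"
  by (force simp: box_def set_Cons_def)

lemma Cons_in_box [simp]: "i # e \<in> box (n # ns) \<longleftrightarrow> i < n \<and> e \<in> box ns"
  by (auto simp: box_Cons)

lemma sum_box_Cons:
  "(\<Sum>e\<in>box (n # ns). f e) = (\<Sum>i<n. \<Sum>e\<in>box ns. f (i # e))"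
proof -
  have "(\<Sum>e\<in>box (n # ns). f e) = (\<Sum>(i, e)\<in>{..<n} \<times> box ns. f (i # e))"
    unfolding box_Cons by (subst sum.reindex) (auto simp: inj_on_def case_prod_unfold)
  then show ?thesis by (simp add: sum.cartesian_product)
qed

lemma finite_box [simp]: "finite (box ns)"
  by (induction ns) (auto simp: box_Cons)

lemma card_box [simp]: "card (box ns) = prod_list ns"
  by (induction ns) (auto simp: box_Cons card_image inj_on_def)

fun characters :: "int \<Rightarrow> nat list \<Rightarrow> nat list \<Rightarrow> nat list \<Rightarrow> complex" where
  "characters \<sigma> (n # ns) (i # e) (j # f) = unity \<sigma> n (i * j) * characters \<sigma> ns e f"
| "characters \<sigma> _ _ _ = 1"

lemma multi_fft_c_correct:
  "e \<in> box ns \<Longrightarrow> val (multi_fft_c \<sigma> ns a) e = (\<Sum>f\<in>box ns. a f * characters \<sigma> ns f e)"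
proof (induction ns arbitrary: a e)
  case (Cons n ns)
  then obtain j e' where e: "e = j # e'" "j < n" "e' \<in> box ns" by (auto simp: box_Cons)
  have "val (multi_fft_c \<sigma> (n # ns) a) e =
      (\<Sum>i<n. (\<lambda>i\<in>{..<n}. val (multi_fft_c \<sigma> ns (\<lambda>e. a (i # e)))) i e' * unity \<sigma> n (i * j))"
    using e by (simp add: fft_c_correct)
  also have "\<dots> = (\<Sum>i<n. (\<Sum>f\<in>box ns. a (i # f) * characters \<sigma> ns f e') * unity \<sigma> n (i * j))"
    using e by (intro sum.cong refl) (simp add: Cons.IH)
  also have "\<dots> = (\<Sum>f\<in>box (n # ns). a f * characters \<sigma> (n # ns) f e)"
    unfolding e sum_box_Cons by (simp add: sum_distrib_right sum_distrib_left mult_ac)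
  finally show ?case .
qed simp

fun add_box :: "nat list \<Rightarrow> nat list \<Rightarrow> nat list \<Rightarrow> nat list" where
  "add_box (n # ns) (i # e) (j # f) = ((i + j) mod n) # add_box ns e f"
| "add_box _ _ _ = []"

lemma add_box_in_box: "e \<in> box ns \<Longrightarrow> f \<in> box ns \<Longrightarrow> add_box ns e f \<in> box ns"
  by (induction ns e f rule: add_box.induct) (auto simp: box_Cons)

lemma sum_unity:
  assumes "n > 0" "j < n"
  shows "(\<Sum>i<n. unity 1 n (j * i)) = (if j = 0 then of_nat n else 0)"
proof (cases "j = 0")
  case False
  have pow: "unity 1 n (j * i) = unity 1 n j ^ i" for i
    by (induction i) (simp_all add: unity_add)
  have "unity 1 n j \<noteq> 1"
  proof
    assume "unity 1 n j = 1"
    then have "cos (2 * pi * real j / real n) = 1" by (simp add: unity_def complex_eq_iff)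
    then obtain z :: int where "2 * pi * real j / real n = of_int z * 2 * pi"
      using cos_one_2pi_int by auto
    then have "2 * pi * real j / real n / (2 * pi) = of_int z" by simp
    then have "real j / real n = of_int z" by simp
    moreover have "0 < real j / real n" "real j / real n < 1" using assms False by auto
    ultimately have "0 < z" "z < 1" by auto
    then show False by simp
  qed
  moreover have "unity 1 n j ^ n = 1"
    using pow[of n] unity_mult_self[OF assms(1), of 1 j] by (simp add: mult.commute)
  ultimately show ?thesis
    using False sum_gp_strict[of "unity 1 n j" n] by (simp add: pow)
qed simp

lemma unity_minus: "unity (-1) n j = inverse (unity 1 n j)"
  by (simp add: unity_def cis_inverse)

lemma sum_unity3:
  assumes "i < n" "j < n" "l < n"
  shows "(\<Sum>e<n. unity 1 n (i * e) * unity (-1) n (j * e) * unity (-1) n (e * l)) =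
           (if i = (j + l) mod n then of_nat n else 0)"
proof -
  have n: "n > 0" using assms by simp
  define t where "t = (i + (n - (j + l) mod n)) mod n"
  have tn: "t < n" using n by (simp add: t_def)
  have nz: "unity 1 n q \<noteq> 0" for q by (simp add: unity_def)
  have "unity 1 n (i * e) * unity (-1) n (j * e) * unity (-1) n (e * l) = unity 1 n (t * e)" for e
  proof -
    have "unity 1 n (t * e) * unity 1 n ((j + l) * e) = unity 1 n (t * e + (j + l) * e)"
      by (simp add: unity_add)
    also have "\<dots> = unity 1 n (i * e)"
    proof (rule unity_cong[OF n])
      have "(t + (j + l)) mod n = (i + (n - (j + l) mod n) + (j + l) mod n) mod n"
        unfolding t_def by (simp add: mod_simps)
      also have "i + (n - (j + l) mod n) + (j + l) mod n = i + n"
        using mod_less_divisor[OF n, of "j + l"] by linarith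
      finally have "(t + (j + l)) mod n = i mod n" by simp
      then show "(t * e + (j + l) * e) mod n = i * e mod n"
        by (metis add_mult_distrib mod_mult_left_eq)
    qed
    also have "unity 1 n ((j + l) * e) = unity 1 n (j * e) * unity 1 n (e * l)"
      by (simp add: unity_add[symmetric] algebra_simps)
    finally have "unity 1 n (i * e) = unity 1 n (t * e) * (unity 1 n (j * e) * unity 1 n (e * l))"
      by simp
    then show ?thesis using nz by (simp add: unity_minus field_simps)
  qed
  then have "(\<Sum>e<n. unity 1 n (i * e) * unity (-1) n (j * e) * unity (-1) n (e * l)) =
      (if t = 0 then of_nat n else 0)"
    using sum_unity[OF n tn] by simp
  moreover have "t = 0 \<longleftrightarrow> i = (j + l) mod n"
  proof
    assume "i = (j + l) mod n" then show "t = 0" using n by (simp add: t_def less_imp_le)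
  next
    assume t0: "t = 0"
    define q where "q = (j + l) mod n"
    have q: "q < n" using n by (simp add: q_def)
    have "n dvd (i + (n - q))" using t0 by (simp add: t_def q_def mod_eq_0_iff_dvd)
    then obtain z where z: "i + (n - q) = n * z" by blast
    have "0 < i + (n - q)" "i + (n - q) < 2 * n" using q assms by auto
    then have "z = 1" unfolding z using n by (cases z; cases "z - 1") auto
    then show "i = (j + l) mod n" using z q by (simp add: q_def[symmetric])
  qed
  ultimately show ?thesis by simp
qed

lemma sum_characters3:
  "f \<in> box ns \<Longrightarrow> h \<in> box ns \<Longrightarrow> l \<in> box ns \<Longrightarrow>
   (\<Sum>e\<in>box ns. characters 1 ns f e * characters (-1) ns h e * characters (-1) ns e l) =
     (if f = add_box ns h l then of_nat (prod_list ns) else 0)"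
proof (induction ns arbitrary: f h l)
  case (Cons n ns)
  from Cons.prems obtain i f' j h' q l' where
    *: "f = i # f'" "h = j # h'" "l = q # l'" "i < n" "j < n" "q < n"
      "f' \<in> box ns" "h' \<in> box ns" "l' \<in> box ns"
    by (auto simp: box_Cons)
  have "(\<Sum>e\<in>box (n # ns). characters 1 (n # ns) f e * characters (-1) (n # ns) h e *
            characters (-1) (n # ns) e l) =
      (\<Sum>i'<n. \<Sum>e\<in>box ns. (unity 1 n (i * i') * unity (-1) n (j * i') * unity (-1) n (i' * q)) *
         (characters 1 ns f' e * characters (-1) ns h' e * characters (-1) ns e l'))"
    by (simp add: sum_box_Cons * mult_ac)
  also have "\<dots> = (\<Sum>i'<n. unity 1 n (i * i') * unity (-1) n (j * i') * unity (-1) n (i' * q)) *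
      (\<Sum>e\<in>box ns. characters 1 ns f' e * characters (-1) ns h' e * characters (-1) ns e l')"
    by (simp add: sum_product)
  also have "\<dots> = (if f = add_box (n # ns) h l then of_nat (prod_list (n # ns)) else 0)"
    using sum_unity3[OF *(4,5,6)] Cons.IH[OF *(7,8,9)] by (simp add: *)
  finally show ?case .
qed simp

definition wdigit :: "nat \<Rightarrow> real \<Rightarrow> nat \<Rightarrow> nat" where
  "wdigit b y i = nat (\<lfloor>y * real b ^ Suc i\<rfloor> mod int b)"

lemma wdigit_less: "b > 0 \<Longrightarrow> wdigit b y i < b"
  unfolding wdigit_def by (simp add: nat_less_iff)

lemma wal_prod:
  assumes b: "b \<ge> 2" and h: "h < b ^ A"
  shows "wal b h y = (\<Prod>i<A. unity 1 b ((h div b ^ i mod b) * wdigit b y i))"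
proof -
  have sub: "{i. b ^ i \<le> h} \<subseteq> {..<A}"
  proof
    fix i assume "i \<in> {i. b ^ i \<le> h}"
    then have "b ^ i < b ^ A" using h by simp
    then show "i \<in> {..<A}" using b by (simp add: power_strict_increasing_iff)
  qed
  have "(\<Sum>i | b ^ i \<le> h. real (h div b ^ i mod b) * real_of_int (\<lfloor>y * real b ^ Suc i\<rfloor> mod int b))
      = (\<Sum>i<A. real (h div b ^ i mod b) * real_of_int (\<lfloor>y * real b ^ Suc i\<rfloor> mod int b))"
    by (rule sum.mono_neutral_left) (use sub in auto)
  also have "\<dots> = (\<Sum>i<A. real ((h div b ^ i mod b) * wdigit b y i))"
    using b by (simp add: wdigit_def)
  finally have *: "wal b h y =
      cis (\<Sum>i<A. 2 * pi / real b * real ((h div b ^ i mod b) * wdigit b y i))"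
    by (simp add: wal_def sum_distrib_left)
  have cis_sum: "cis (\<Sum>i<A. F i) = (\<Prod>i<A. cis (F i))" for F
    by (induction A) (auto simp: cis_mult[symmetric])
  show ?thesis unfolding * cis_sum unity_def by simp
qed

lemma sum_wal:
  assumes b: "b \<ge> 2"
  shows "(\<Sum>h<b ^ A. wal b h y) = (if \<forall>i<A. wdigit b y i = 0 then of_nat b ^ A else 0)"
proof (induction A)
  case 0
  show ?case using wal_prod[OF b, of 0 0] by simp
next
  case (Suc A)
  have b0: "b > 0" using b by simp
  have step: "wal b (b ^ A * c + r) y = wal b r y * unity 1 b (wdigit b y A * c)"
    if r: "r < b ^ A" and c: "c < b" for r c
  proof -
    have "b ^ A * c + r < b ^ A * (c + 1)" using r by simp
    also have "\<dots> \<le> b ^ A * b" using c by (intro mult_le_mono2) simp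
    finally have less: "b ^ A * c + r < b ^ Suc A" by (simp add: mult.commute)
    have low: "(b ^ A * c + r) div b ^ i mod b = r div b ^ i mod b" if "i < A" for i
    proof -
      obtain t where "A = i + Suc t" using less_imp_Suc_add[OF \<open>i < A\<close>] by auto
      then have "b ^ A * c + r = r + b ^ i * (b * (b ^ t * c))" by (simp add: power_add mult_ac)
      then have "(b ^ A * c + r) div b ^ i = (r + b ^ i * (b * (b ^ t * c))) div b ^ i" by (rule arg_cong)
      also have "\<dots> = b * (b ^ t * c) + r div b ^ i" using b by (intro div_mult_self2) simp
      finally show ?thesis by simp
    qed
    have high: "(b ^ A * c + r) div b ^ A mod b = c" using r c b by simp
    show ?thesis
      unfolding wal_prod[OF b less] wal_prod[OF b r] by (simp add: low high mult.commute[of c "wdigit b y A"])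
  qed
  have "(\<Sum>h<b ^ Suc A. wal b h y) = (\<Sum>r<b ^ A. \<Sum>c<b. wal b (b ^ A * c + r) y)"
    using sum_residue_split[of "b ^ A" "\<lambda>h. wal b h y" b] b by (simp add: mult.commute)
  also have "\<dots> = (\<Sum>r<b ^ A. \<Sum>c<b. wal b r y * unity 1 b (wdigit b y A * c))"
    by (intro sum.cong refl) (simp add: step)
  also have "\<dots> = (\<Sum>h<b ^ A. wal b h y) * (\<Sum>c<b. unity 1 b (wdigit b y A * c))"
    by (simp only: sum_product)
  also have "\<dots> = (if \<forall>i<Suc A. wdigit b y i = 0 then of_nat b ^ Suc A else 0)"
    unfolding Suc.IH sum_unity[OF b0 wdigit_less[OF b0]] by (auto simp: less_Suc_eq)
  finally show ?case .
qed

lemma floor_log_block: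
  assumes "b \<ge> 2" "b ^ a \<le> h" "h < b ^ Suc a"
  shows "\<lfloor>log (real b) (real h)\<rfloor> = int a"
proof -
  have h: "real h > 0" using assms by (metis gr0I le_zero_eq not_numeral_le_zero of_nat_0_less_iff power_eq_0_iff)
  have 1: "real b powr real_of_int (int a) \<le> real h"
    using assms by (simp add: powr_realpow flip: of_nat_power)
  have "real h < real (b ^ Suc a)" using assms(3) by (simp only: of_nat_less_iff)
  also have "\<dots> = real b powr real (Suc a)"
    using assms(1) by (subst powr_realpow) auto
  finally have 2: "real h < real b powr real_of_int (int a + 1)" by (simp add: add.commute)
  show ?thesis
    using floor_log_eq_powr_iff[OF h, of "real b" "int a"] assms(1) 1 2 by simp
qed

lemma sum_blocks:
  fixes F :: "nat \<Rightarrow> complex" and \<alpha> :: real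
  assumes b: "b \<ge> 2"
  shows "(\<Sum>i<b ^ A - 1. of_real (real b powr (- \<alpha> * \<lfloor>log (real b) (real (Suc i))\<rfloor>)) * F (Suc i)) =
    (\<Sum>a<A. of_real (real b powr (- \<alpha> * real a)) * ((\<Sum>h<b ^ Suc a. F h) - (\<Sum>h<b ^ a. F h)))"
    (is "?L A = ?R A")
proof (induction A)
  case (Suc A)
  define H where "H h = of_real (real b powr (- \<alpha> * \<lfloor>log (real b) (real h)\<rfloor>)) * F h" for h
  have le: "b ^ A \<le> b ^ Suc A" and pos: "b ^ A \<ge> 1" using b by auto
  have "?L (Suc A) = (\<Sum>i<b ^ Suc A - 1. H (Suc i))" by (simp add: H_def)
  also have "\<dots> = sum H {1..<b ^ Suc A}"
    by (rule sum.reindex_bij_witness[of _ "\<lambda>h. h - 1" Suc]) auto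
  also have "\<dots> = sum H {1..<b ^ A} + sum H {b ^ A..<b ^ Suc A}"
    using le pos by (intro sum.atLeastLessThan_concat[symmetric]) auto
  also have "sum H {1..<b ^ A} = (\<Sum>i<b ^ A - 1. H (Suc i))"
    by (rule sum.reindex_bij_witness[of _ Suc "\<lambda>h. h - 1"]) auto
  also have "\<dots> = ?R A" unfolding Suc.IH[symmetric] by (simp add: H_def)
  also have "sum H {b ^ A..<b ^ Suc A} =
      (\<Sum>h\<in>{b ^ A..<b ^ Suc A}. of_real (real b powr (- \<alpha> * real A)) * F h)"
  proof (intro sum.cong refl)
    fix h assume "h \<in> {b ^ A..<b ^ Suc A}"
    then have "\<lfloor>log (real b) (real h)\<rfloor> = int A" by (intro floor_log_block[OF b]) auto
    then show "H h = of_real (real b powr (- \<alpha> * real A)) * F h" by (simp add: H_def)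
  qed
  also have "\<dots> = of_real (real b powr (- \<alpha> * real A)) * sum F {b ^ A..<b ^ Suc A}"
    by (simp only: sum_distrib_left)
  also have "sum F {b ^ A..<b ^ Suc A} = sum F {..<b ^ Suc A} - sum F {..<b ^ A}"
    using sum.atLeastLessThan_concat[of 0 "b ^ A" "b ^ Suc A" F] le
    by (metis add_diff_cancel_left' lessThan_atLeast0 zero_le)
  finally show ?case by simp
qed simp

context
  fixes b :: nat and \<alpha> q :: real
  assumes b: "b \<ge> 2" and \<alpha>: "\<alpha> > 1" and q: "q = real b powr (1 - \<alpha>)"
begin

lemma q01: "0 < q" "q < 1"
  using b \<alpha> powr_less_one[of "real b" "1 - \<alpha>"] by (auto simp: q)

lemma weight_eq: "real b powr (- \<alpha> * real a) * real b ^ a = q ^ a"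
proof -
  have "real b powr (- \<alpha> * real a) * real b ^ a = real b powr (- \<alpha> * real a + real a)"
    using b by (subst powr_add) (simp add: powr_realpow)
  also have "- \<alpha> * real a + real a = (1 - \<alpha>) * real a" by (simp add: algebra_simps)
  also have "real b powr \<dots> = q ^ a"
    using b by (simp add: q powr_powr[symmetric] powr_realpow)
  finally show ?thesis .
qed

lemma geometric: "(real b - 1) * (\<Sum>a<A. q ^ a) = (real b - 1) / (1 - q) * (1 - q ^ A)"
  using q01 sum_gp_strict[of q A] by simp

lemma sum_weights:
  "(\<Sum>i<b ^ A - 1. real b powr (- \<alpha> * \<lfloor>log (real b) (real (Suc i))\<rfloor>)) =
     (real b - 1) / (1 - q) * (1 - q ^ A)" (is "?L = _")
proof -
  have "complex_of_real ?L = (\<Sum>a<A. of_real (real b powr (- \<alpha> * real a)) *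
      ((\<Sum>h<b ^ Suc a. 1) - (\<Sum>h<b ^ a. 1)))"
    unfolding sum_blocks[OF b, where F = "\<lambda>_. 1", symmetric] by simp
  also have "\<dots> = (\<Sum>a<A. of_real (real b - 1) * of_real (real b powr (- \<alpha> * real a) * real b ^ a))"
    by (intro sum.cong refl) (simp add: algebra_simps)
  also have "\<dots> = of_real ((real b - 1) * (\<Sum>a<A. q ^ a))"
    unfolding weight_eq by (simp add: sum_distrib_left)
  finally show ?thesis unfolding geometric of_real_eq_iff .
qed

lemma summable_walsh:
  "summable (\<lambda>i. complex_of_real (real b powr (- \<alpha> * \<lfloor>log (real b) (real (Suc i))\<rfloor>)) * wal b (Suc i) y)"
proof (rule summable_norm_cancel)
  define W where "W i = real b powr (- \<alpha> * \<lfloor>log (real b) (real (Suc i))\<rfloor>)" for i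
  have "summable W"
  proof (rule summableI_nonneg_bounded)
    fix n
    have "n < b ^ n" using b by (intro power_gt_expt) auto
    then have "sum W {..<n} \<le> sum W {..<b ^ n - 1}"
      by (intro sum_mono2) (auto simp: W_def)
    also have "\<dots> = (real b - 1) / (1 - q) * (1 - q ^ n)"
      unfolding W_def by (rule sum_weights)
    also have "\<dots> \<le> (real b - 1) / (1 - q) * 1"
      using b q01 by (intro mult_left_mono) auto
    finally show "sum W {..<n} \<le> (real b - 1) / (1 - q)" by simp
  qed (simp add: W_def)
  moreover have "(\<lambda>i. norm (complex_of_real (real b powr (- \<alpha> * \<lfloor>log (real b) (real (Suc i))\<rfloor>)) * wal b (Suc i) y)) = W"
    by (auto simp: fun_eq_iff norm_mult wal_def W_def)
  ultimately show "summable (\<lambda>i. norm (complex_of_real (real b powr (- \<alpha> * \<lfloor>log (real b) (real (Suc i))\<rfloor>)) * wal b (Suc i) y))"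
    by simp
qed

lemma walsh_phi_limit:
  "(\<lambda>A. \<Sum>a<A. of_real (real b powr (- \<alpha> * real a)) *
      ((\<Sum>h<b ^ Suc a. wal b h y) - (\<Sum>h<b ^ a. wal b h y))) \<longlonglongrightarrow> walsh_phi b \<alpha> y"
proof -
  have "filterlim (\<lambda>A. b ^ A - 1) at_top sequentially"
  proof (rule filterlim_at_top_mono[OF filterlim_ident])
    show "\<forall>\<^sub>F A in sequentially. A \<le> b ^ A - 1"
    proof (rule always_eventually, rule allI)
      fix A
      have "A < b ^ A" using b by (intro power_gt_expt) auto
      then show "A \<le> b ^ A - 1" by simp
    qed
  qed
  from filterlim_compose[OF summable_LIMSEQ[OF summable_walsh] this]
  show ?thesis unfolding sum_blocks[OF b, symmetric] walsh_phi_def by simp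
qed

lemma walsh_phi_zero:
  assumes "\<And>i. wdigit b y i = 0"
  shows "walsh_phi b \<alpha> y = of_real ((real b - 1) / (1 - q))"
proof -
  have "(\<Sum>a<A. of_real (real b powr (- \<alpha> * real a)) *
      ((\<Sum>h<b ^ Suc a. wal b h y) - (\<Sum>h<b ^ a. wal b h y))) =
      complex_of_real ((real b - 1) / (1 - q) * (1 - q ^ A))" for A
  proof -
    have "(\<Sum>a<A. of_real (real b powr (- \<alpha> * real a)) *
        ((\<Sum>h<b ^ Suc a. wal b h y) - (\<Sum>h<b ^ a. wal b h y))) =
      (\<Sum>a<A. complex_of_real (real b - 1) * of_real (real b powr (- \<alpha> * real a) * real b ^ a))"
      using assms by (intro sum.cong refl) (simp add: sum_wal[OF b] algebra_simps del: power_Suc, simp add: algebra_simps)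
    also have "\<dots> = of_real ((real b - 1) * (\<Sum>a<A. q ^ a))"
      unfolding weight_eq by (simp add: sum_distrib_left)
    finally show ?thesis unfolding geometric .
  qed
  then have "(\<lambda>A. complex_of_real ((real b - 1) / (1 - q) * (1 - q ^ A))) \<longlonglongrightarrow> walsh_phi b \<alpha> y"
    using walsh_phi_limit[of y] by simp
  moreover have "(\<lambda>A. complex_of_real ((real b - 1) / (1 - q) * (1 - q ^ A))) \<longlonglongrightarrow>
      of_real ((real b - 1) / (1 - q) * (1 - 0))"
    using q01 by (intro tendsto_intros LIMSEQ_realpow_zero) auto
  ultimately show ?thesis using LIMSEQ_unique by fastforce
qed

lemma walsh_phi_nonzero:
  assumes low: "\<And>i. i < i0 \<Longrightarrow> wdigit b y i = 0" and "wdigit b y i0 \<noteq> 0"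
  shows "walsh_phi b \<alpha> y = of_real ((real b - 1) / (1 - q) - ((real b - 1) / (1 - q) + 1) * q ^ i0)"
proof -
  define t :: "nat \<Rightarrow> complex" where "t a = of_real (real b powr (- \<alpha> * real a)) *
      ((\<Sum>h<b ^ Suc a. wal b h y) - (\<Sum>h<b ^ a. wal b h y))" for a
  have t1: "t a = of_real ((real b - 1) * q ^ a)" if "a < i0" for a
  proof -
    have "(\<Sum>h<b ^ a. wal b h y) = of_nat b ^ a" "(\<Sum>h<b ^ Suc a. wal b h y) = of_nat b ^ Suc a"
      using that low by (auto simp add: sum_wal[OF b] simp del: power_Suc)
    then have "t a = of_real ((real b - 1) * (real b powr (- \<alpha> * real a) * real b ^ a))"
      by (simp only: t_def) (simp add: algebra_simps)
    then show ?thesis by (simp only: weight_eq)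
  qed
  have S1: "(\<Sum>h<b ^ i0. wal b h y) = of_nat b ^ i0"
    using low by (simp add: sum_wal[OF b])
  have S2: "(\<Sum>h<b ^ Suc i0. wal b h y) = 0"
    using assms(2) unfolding sum_wal[OF b] by auto
  have t2: "t i0 = of_real (- (q ^ i0))"
  proof -
    have "t i0 = - of_real (real b powr (- \<alpha> * real i0) * real b ^ i0)"
      by (simp only: t_def S1 S2) simp
    then show ?thesis by (simp only: weight_eq of_real_minus)
  qed
  have t3: "t a = 0" if "a > i0" for a
  proof -
    have "(\<Sum>h<b ^ a. wal b h y) = 0" "(\<Sum>h<b ^ Suc a. wal b h y) = 0"
      using that assms(2) unfolding sum_wal[OF b] by auto
    then show ?thesis by (simp only: t_def) simp
  qed
  have "(\<Sum>a<A. t a) = of_real ((real b - 1) / (1 - q) * (1 - q ^ i0) - q ^ i0)" if "A > i0" for A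
  proof -
    have "(\<Sum>a<A. t a) = (\<Sum>a<Suc i0. t a)"
      using that t3 by (intro sum.mono_neutral_right) auto
    also have "\<dots> = (\<Sum>a<i0. of_real ((real b - 1) * q ^ a)) + of_real (- (q ^ i0))"
      using t1 t2 by simp
    also have "\<dots> = of_real ((real b - 1) * (\<Sum>a<i0. q ^ a) - q ^ i0)"
      by (simp add: sum_distrib_left)
    finally show ?thesis unfolding geometric .
  qed
  then have "\<forall>\<^sub>F A in sequentially.
      (\<Sum>a<A. t a) = of_real ((real b - 1) / (1 - q) * (1 - q ^ i0) - q ^ i0)"
    using eventually_gt_at_top[of i0] by (rule eventually_mono[rotated])
  then have "(\<lambda>A. \<Sum>a<A. t a) \<longlonglongrightarrow> of_real ((real b - 1) / (1 - q) * (1 - q ^ i0) - q ^ i0)"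
    by (rule tendsto_eventually)
  moreover have "(\<lambda>A. \<Sum>a<A. t a) \<longlonglongrightarrow> walsh_phi b \<alpha> y"
    unfolding t_def by (rule walsh_phi_limit)
  ultimately have "walsh_phi b \<alpha> y = of_real ((real b - 1) / (1 - q) * (1 - q ^ i0) - q ^ i0)"
    using LIMSEQ_unique by blast
  moreover have "x * (1 - z) - z = x - (x + 1) * z" for x z :: real by (simp add: algebra_simps)
  ultimately show ?thesis by (simp only:)
qed

end

lemma wdigit_fraction:
  assumes "b \<ge> 2"
  shows "wdigit b (real N / real b ^ m) i = (if i < m then N div b ^ (m - 1 - i) mod b else 0)"
proof (cases "i < m")
  case True
  then obtain t where t: "m = Suc i + t" using less_iff_Suc_add by (metis add_Suc add_Suc_right)
  have "real N / real b ^ m * real b ^ Suc i = real N / real (b ^ t)"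
    using assms by (simp add: t power_add)
  then have "\<lfloor>real N / real b ^ m * real b ^ Suc i\<rfloor> = int (N div b ^ t)"
    by (simp only: floor_divide_of_nat_eq)
  then show ?thesis using True t by (simp add: wdigit_def flip: zmod_int)
next
  case False
  then obtain t where t: "i = m + t" using le_iff_add by (metis not_less)
  have "real N / real b ^ m * real b ^ Suc i = real_of_int (int (N * b ^ t * b))"
    using assms by (simp add: t power_add)
  then have "\<lfloor>real N / real b ^ m * real b ^ Suc i\<rfloor> = int (N * b ^ t * b)"
    by (simp only: floor_of_int)
  then show ?thesis using False by (simp add: wdigit_def)
qed

definition poly_num :: "nat \<Rightarrow> 'p::prime_card mod_ring poly \<Rightarrow> nat" where
  "poly_num m f = (\<Sum>i<m. nat (to_int_mod_ring (coeff f i)) * CARD('p) ^ i)"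

lemma to_int_mod_ring_bounds:
  "0 \<le> to_int_mod_ring (c :: 'p::prime_card mod_ring)"
  "to_int_mod_ring (c :: 'p::prime_card mod_ring) < int CARD('p)"
proof -
  have "to_int_mod_ring c \<in> {0..<int CARD('p)}"
    unfolding range_to_int_mod_ring[symmetric] by (rule rangeI)
  then show "0 \<le> to_int_mod_ring c" "to_int_mod_ring c < int CARD('p)" by auto
qed

lemma nu_eq_poly_num: "nu m (f :: 'p::prime_card mod_ring poly) = real (poly_num m f) / real CARD('p) ^ m"
proof -
  have "real_of_int (to_int_mod_ring (coeff f i)) / real CARD('p) ^ (m - i) =
      real (nat (to_int_mod_ring (coeff f i)) * CARD('p) ^ i) / real CARD('p) ^ m" if "i < m" for i
  proof -
    have "real CARD('p) ^ m = real CARD('p) ^ (m - i) * real CARD('p) ^ i"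
      using that by (simp flip: power_add)
    then show ?thesis by (simp add: to_int_mod_ring_bounds)
  qed
  then show ?thesis unfolding nu_def poly_num_def by (simp add: sum_divide_distrib)
qed

lemma CARD_ge_2: "CARD('p::prime_card) \<ge> 2"
  using prime_card[where 'a = 'p] prime_ge_2_nat by blast

lemma poly_num_upper:
  "(\<Sum>i<k. nat (to_int_mod_ring (coeff (f :: 'p::prime_card mod_ring poly) i)) * CARD('p) ^ i) < CARD('p) ^ k"
proof (induction k)
  case (Suc k)
  have "nat (to_int_mod_ring (coeff f k)) + 1 \<le> CARD('p)"
    using to_int_mod_ring_bounds[of "coeff f k"] by linarith
  then have "(nat (to_int_mod_ring (coeff f k)) + 1) * CARD('p) ^ k \<le> CARD('p) * CARD('p) ^ k"
    by (rule mult_le_mono1)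
  then show ?case using Suc by simp
qed simp

lemma poly_num_bounds:
  fixes f :: "'p::prime_card mod_ring poly"
  assumes "f \<noteq> 0" "degree f < m"
  shows "CARD('p) ^ degree f \<le> poly_num m f" "poly_num m f < CARD('p) ^ Suc (degree f)"
proof -
  have *: "poly_num m f = (\<Sum>i<Suc (degree f). nat (to_int_mod_ring (coeff f i)) * CARD('p) ^ i)"
    unfolding poly_num_def using assms
    by (intro sum.mono_neutral_right) (auto simp: coeff_eq_0)
  show "poly_num m f < CARD('p) ^ Suc (degree f)"
    unfolding * by (rule poly_num_upper)
  have "to_int_mod_ring (coeff f (degree f)) \<noteq> 0"
    using assms(1) by simp
  then have "1 \<le> nat (to_int_mod_ring (coeff f (degree f)))"
    using to_int_mod_ring_bounds(1)[of "coeff f (degree f)"] by linarith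
  then have "1 * CARD('p) ^ degree f \<le> nat (to_int_mod_ring (coeff f (degree f))) * CARD('p) ^ degree f"
    by (rule mult_le_mono1)
  then show "CARD('p) ^ degree f \<le> poly_num m f"
    unfolding * sum.lessThan_Suc by linarith
qed

lemma powers_c_correct:
  assumes "\<And>i. val (M (x' i) x) = x' (Suc i)"
  shows "i \<le> n \<Longrightarrow> val (powers_c M (x' 0) x n) i = x' i"
proof (induction n arbitrary: i)
  case (Suc n)
  then show ?case by (cases "i = Suc n") (simp_all add: assms)
qed simp

theorem phi_table_correct:
  fixes f :: "'p::prime_card mod_ring poly"
  assumes \<alpha>: "\<alpha> > 1" and f: "f \<in> polys_below m"
  shows "complex_of_real (val (phi_table_c \<alpha> m) f) = walsh_phi CARD('p) \<alpha> (nu m f)"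
proof -
  let ?b = "CARD('p)"
  define q where "q = real ?b powr (1 - \<alpha>)"
  note b = CARD_ge_2[where 'p = 'p]
  have pw: "i \<le> m \<Longrightarrow> val (powers_c mul_c 1 q m) i = q ^ i" for i
    using powers_c_correct[of mul_c "\<lambda>i. q ^ i" q i m] by simp
  show ?thesis
  proof (cases "f = 0")
    case True
    have "wdigit ?b (nu m f) i = 0" for i
      using wdigit_fraction[OF b, of 0 m i] True by (simp add: nu_def)
    from walsh_phi_zero[OF b \<alpha> q_def this] show ?thesis
      using f True by (simp add: phi_table_c_def q_def)
  next
    case False
    then have deg: "degree f < m" using f by (simp add: polys_below_def)
    define i0 where "i0 = m - 1 - degree f"
    note bounds = poly_num_bounds[OF False deg]
    have dig: "wdigit ?b (nu m f) i = (if i < m then poly_num m f div ?b ^ (m - 1 - i) mod ?b else 0)" for i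
      unfolding nu_eq_poly_num by (rule wdigit_fraction[OF b])
    have "wdigit ?b (nu m f) i = 0" if "i < i0" for i
    proof -
      have "?b ^ Suc (degree f) \<le> ?b ^ (m - 1 - i)"
        using that b by (intro power_increasing) (auto simp: i0_def)
      then show ?thesis using bounds by (simp add: dig)
    qed
    moreover have "wdigit ?b (nu m f) i0 \<noteq> 0"
    proof -
      have "m - 1 - i0 = degree f" "i0 < m" using deg by (auto simp: i0_def)
      moreover have "poly_num m f div ?b ^ degree f < ?b"
        using bounds(2) by (simp add: less_mult_imp_div_less)
      moreover have "poly_num m f div ?b ^ degree f > 0"
        using bounds(1) by (simp add: div_greater_zero_iff)
      ultimately show ?thesis by (simp add: dig)
    qed
    ultimately have "walsh_phi ?b \<alpha> (nu m f) =
        of_real ((real ?b - 1) / (1 - q) - ((real ?b - 1) / (1 - q) + 1) * q ^ i0)"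
      by (rule walsh_phi_nonzero[OF b \<alpha> q_def])
    moreover have "val (powers_c mul_c 1 q m) (m - Suc (degree f)) = q ^ i0"
      using pw[of i0] by (simp add: i0_def)
    ultimately show ?thesis
      using f False by (simp add: phi_table_c_def q_def[symmetric])
  qed
qed

lemma polys_below_0 [simp]: "polys_below 0 = {0}"
  by (auto simp: polys_below_def)

lemma polys_below_iff_coeff: "f \<in> polys_below k \<longleftrightarrow> (\<forall>i\<ge>k. coeff f i = 0)"
proof
  assume "f \<in> polys_below k"
  then show "\<forall>i\<ge>k. coeff f i = 0" by (auto simp: polys_below_def coeff_eq_0)
next
  assume *: "\<forall>i\<ge>k. coeff f i = 0"
  have "degree f < k" if "f \<noteq> 0"
    using * that by (metis leading_coeff_0_iff not_less)
  then show "f \<in> polys_below k" by (auto simp: polys_below_def)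
qed

lemma pCons_in_polys_below [simp]: "pCons c f \<in> polys_below (Suc k) \<longleftrightarrow> f \<in> polys_below k"
  by (auto simp: polys_below_iff_coeff coeff_pCons Suc_le_D split: nat.splits)

lemma polys_below_Suc: "polys_below (Suc k) = (\<lambda>(c, f). pCons c f) ` (UNIV \<times> polys_below k)"
proof (intro equalityI subsetI)
  fix f assume f: "f \<in> polys_below (Suc k)"
  then show "f \<in> (\<lambda>(c, f). pCons c f) ` (UNIV \<times> polys_below k)"
    by (cases f) auto
qed auto

lemma finite_polys_below [simp]: "finite (polys_below k)"
  by (induction k) (auto simp: polys_below_Suc)

lemma finite_unit_polys [simp]: "finite (unit_polys k)"
  by (simp add: unit_polys_def)

lemma X_pow_neq_0 [simp]: "(X_pow k :: 'p::prime_card mod_ring poly) \<noteq> 0"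
  by simp

lemma mod_X_pow_in_polys_below: "f mod X_pow k \<in> polys_below k"
  using degree_mod_less[of "X_pow k" f] by (auto simp: polys_below_def degree_monom_eq)

lemma mod_X_pow_id: "f \<in> polys_below k \<Longrightarrow> f mod X_pow k = f"
  by (cases "f = 0") (auto simp: polys_below_def degree_monom_eq intro!: mod_poly_less)

lemma coeff_mod_X_pow: 
  fixes f :: "'p::prime_card mod_ring poly"
  assumes "i < k" shows "coeff (f mod X_pow k) i = coeff f i"
proof -
  have "coeff f i = coeff (X_pow k * (f div X_pow k) + f mod X_pow k) i" by simp
  also have "\<dots> = coeff (f mod X_pow k) i"
    using assms by (simp only: coeff_add coeff_monom_mult) simp
  finally show ?thesis by simp
qed

lemma nu_mod: "nu k (f mod X_pow k) = nu k f"
  unfolding nu_def by (simp add: coeff_mod_X_pow)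

lemma nu_shift: "j \<le> m \<Longrightarrow> nu m (X_pow (m - j) * f) = nu j f"
proof -
  assume j: "j \<le> m"
  have "nu m (X_pow (m - j) * f) =
    (\<Sum>i\<in>{m - j..<m}. real_of_int (to_int_mod_ring (coeff f (i - (m - j)))) / real CARD('a) ^ (m - i))"
    unfolding nu_def using j
    by (intro sum.mono_neutral_cong_right) (auto simp: coeff_monom_mult)
  also have "\<dots> = nu j f"
    unfolding nu_def
    by (rule sum.reindex_bij_witness[of _ "\<lambda>i. i + (m - j)" "\<lambda>i. i - (m - j)"]) (use j in auto)
  finally show ?thesis .
qed

lemma shift_in_polys_below: "j \<le> m \<Longrightarrow> f \<in> polys_below j \<Longrightarrow> X_pow (m - j) * f \<in> polys_below m"
  by (auto simp: polys_below_iff_coeff coeff_monom_mult)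

lemma one_in_unit_polys: "k \<ge> 1 \<Longrightarrow> 1 \<in> unit_polys k"
  by (simp add: unit_polys_def polys_below_def)

lemma mod_in_unit_polys: "k \<ge> 1 \<Longrightarrow> coeff f 0 \<noteq> 0 \<Longrightarrow> f mod X_pow k \<in> unit_polys k"
  using coeff_mod_X_pow[of 0 k f] by (simp add: unit_polys_def mod_X_pow_in_polys_below)

lemma sum_polys_below:
  "sum F (polys_below k) = F 0 + (\<Sum>j=1..k. \<Sum>n\<in>unit_polys j. F (X_pow (k - j) * n))"
  for F :: "'p::prime_card mod_ring poly \<Rightarrow> complex"
proof (induction k arbitrary: F)
  case (Suc k)
  have split: "polys_below (Suc k) = unit_polys (Suc k) \<union> pCons 0 ` polys_below k"
    by (auto simp: polys_below_Suc unit_polys_def)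
  have disj: "unit_polys (Suc k) \<inter> pCons 0 ` polys_below k = {}"
    by (auto simp: unit_polys_def)
  have "sum F (polys_below (Suc k)) = sum F (unit_polys (Suc k)) + sum F (pCons 0 ` polys_below k)"
    unfolding split by (rule sum.union_disjoint) (use disj in auto)
  also have "sum F (pCons 0 ` polys_below k) = sum (\<lambda>f. F (pCons 0 f)) (polys_below k)"
    by (subst sum.reindex) (auto simp: inj_on_def)
  also have "\<dots> = F 0 + (\<Sum>j=1..k. \<Sum>n\<in>unit_polys j. F (pCons 0 (X_pow (k - j) * n)))"
    unfolding Suc.IH by simp
  also have "(\<Sum>j=1..k. \<Sum>n\<in>unit_polys j. F (pCons 0 (X_pow (k - j) * n))) =
      (\<Sum>j=1..k. \<Sum>n\<in>unit_polys j. F (X_pow (Suc k - j) * n))"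
    by (intro sum.cong refl) (simp add: Suc_diff_le monom_Suc)
  finally show ?case by (simp add: add_ac)
qed simp

lemma group_table_c_mod:
  assumes k: "k \<ge> 1"
  shows "e \<in> box (map snd D) \<Longrightarrow> val (group_table_c k D) e = power_product D e mod X_pow k"
proof (induction D arbitrary: e)
  case Nil
  then show ?case
    using k by (simp add: power_product_def mod_X_pow_id polys_below_def)
next
  case (Cons gn D)
  obtain g n where gn: "gn = (g, n)" by force
  from Cons.prems obtain i f where e: "e = i # f" "i < n" "f \<in> box (map snd D)"
    by (auto simp: gn box_Cons)
  have 1: "(1 :: 'a mod_ring poly) = g ^ 0 mod X_pow k"
    using k by (simp add: mod_X_pow_id polys_below_def)
  have "val (powers_c (mulmod_c k) (g ^ 0 mod X_pow k) g n) i = g ^ i mod X_pow k"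
    using e by (intro powers_c_correct) (auto simp: mod_mult_right_eq mult.commute)
  then have "val (powers_c (mulmod_c k) 1 g n) i = g ^ i mod X_pow k" using 1 by simp
  then show ?case
    using e Cons.IH[OF e(3)] by (simp add: gn power_product_def mod_mult_eq)
qed

lemma power_product_add:
  assumes "\<forall>(g, n) \<in> set D. [g ^ n = 1] (mod X_pow k)"
  shows "e \<in> box (map snd D) \<Longrightarrow> f \<in> box (map snd D) \<Longrightarrow>
    [power_product D (add_box (map snd D) e f) = power_product D e * power_product D f] (mod X_pow k)"
  using assms
proof (induction D arbitrary: e f)
  case Nil
  then show ?case by (simp add: power_product_def)
next
  case (Cons gn D)
  obtain g n where gn: "gn = (g, n)" by force
  from Cons.prems obtain i e' j f' where *: "e = i # e'" "f = j # f'" "i < n" "j < n"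
    "e' \<in> box (map snd D)" "f' \<in> box (map snd D)"
    by (auto simp: gn box_Cons)
  have gn1: "[g ^ n = 1] (mod X_pow k)" using Cons.prems by (auto simp: gn)
  have "g ^ (i + j) = (g ^ n) ^ ((i + j) div n) * g ^ ((i + j) mod n)"
    by (simp flip: power_mult power_add)
  moreover have "[(g ^ n) ^ ((i + j) div n) * g ^ ((i + j) mod n) = 1 ^ ((i + j) div n) * g ^ ((i + j) mod n)] (mod X_pow k)"
    by (intro cong_mult cong_pow gn1 cong_refl)
  ultimately have "[g ^ ((i + j) mod n) = g ^ i * g ^ j] (mod X_pow k)"
    by (simp add: power_add cong_sym)
  moreover have "[power_product D (add_box (map snd D) e' f') = power_product D e' * power_product D f'] (mod X_pow k)"
    using Cons by (intro Cons.IH) (auto simp: *)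
  ultimately have "[g ^ ((i + j) mod n) * power_product D (add_box (map snd D) e' f') =
      (g ^ i * g ^ j) * (power_product D e' * power_product D f')] (mod X_pow k)"
    by (rule cong_mult)
  then show ?case by (simp add: * gn power_product_def mult_ac)
qed

lemma correlation_c_correct:
  fixes c a :: "'p::prime_card mod_ring poly \<Rightarrow> real"
  assumes k: "k \<ge> 1" and D: "unit_group_decomposition k D" and g: "g \<in> unit_polys k"
  shows "val (correlation_c k D c a) g = (\<Sum>n\<in>unit_polys k. c (n * g mod X_pow k) * a n)"
proof -
  define ns where "ns = map snd D"
  define R where "R = val (group_table_c k D)"
  have R: "R e = power_product D e mod X_pow k" if "e \<in> box ns" for e
    using group_table_c_mod[OF k] that by (simp add: R_def ns_def)
  have orders: "\<forall>(g, n) \<in> set D. [g ^ n = 1] (mod X_pow k)" "\<forall>n\<in>set ns. n \<ge> 2"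
    using D by (auto simp: unit_group_decomposition_def ns_def)
  have "bij_betw (\<lambda>e. power_product D e mod X_pow k) (box ns) (unit_polys k)"
    using D by (simp add: unit_group_decomposition_def ns_def)
  then have bij: "bij_betw R (box ns) (unit_polys k)"
    by (rule bij_betw_cong[THEN iffD1, rotated]) (simp add: R)
  define l where "l = inv_into (box ns) R g"
  have l: "l \<in> box ns" "R l = g"
    using bij g by (auto simp: l_def bij_betw_def inv_into_into f_inv_into_f)
  have R_add: "R (add_box ns h l) = R h * g mod X_pow k" if "h \<in> box ns" for h
  proof -
    have "R (add_box ns h l) = power_product D h * power_product D l mod X_pow k"
      using power_product_add[OF orders(1), of h l] that l add_box_in_box[OF that l(1)]
      by (simp add: R ns_def cong_def)
    also have "\<dots> = R h * R l mod X_pow k" using that l(1) by (simp add: R mod_mult_eq)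
    finally show ?thesis by (simp add: l)
  qed
  define G :: complex where "G = of_nat (prod_list ns)"
  have "prod_list ns \<noteq> 0" using orders(2) by (induction ns) auto
  then have G: "G \<noteq> 0" by (simp add: G_def)
  define C where "C = val (multi_fft_c 1 ns (\<lambda>e. complex_of_real (c (R e))))"
  define A where "A = val (multi_fft_c (-1) ns (\<lambda>e. complex_of_real (a (R e))))"
  define T where "T = val (multi_fft_c (-1) ns (\<lambda>e\<in>box ns. C e * A e))"
  have "T l = (\<Sum>e\<in>box ns. C e * A e * characters (-1) ns e l)"
    using l by (simp add: T_def multi_fft_c_correct)
  also have "\<dots> = (\<Sum>e\<in>box ns. \<Sum>f\<in>box ns. \<Sum>h\<in>box ns. of_real (c (R f)) * of_real (a (R h)) *
      (characters 1 ns f e * characters (-1) ns h e * characters (-1) ns e l))"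
  proof (intro sum.cong refl)
    fix e assume e: "e \<in> box ns"
    have "C e * A e = (\<Sum>f\<in>box ns. \<Sum>h\<in>box ns.
        (of_real (c (R f)) * characters 1 ns f e) * (of_real (a (R h)) * characters (-1) ns h e))"
      by (simp only: C_def A_def multi_fft_c_correct[OF e] sum_product)
    then show "C e * A e * characters (-1) ns e l = (\<Sum>f\<in>box ns. \<Sum>h\<in>box ns.
        of_real (c (R f)) * of_real (a (R h)) *
        (characters 1 ns f e * characters (-1) ns h e * characters (-1) ns e l))"
      by (simp add: sum_distrib_left sum_distrib_right mult_ac)
  qed
  also have "\<dots> = (\<Sum>f\<in>box ns. \<Sum>h\<in>box ns. \<Sum>e\<in>box ns. of_real (c (R f)) * of_real (a (R h)) *
      (characters 1 ns f e * characters (-1) ns h e * characters (-1) ns e l))"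
    by (subst sum.swap, rule sum.cong[OF refl], rule sum.swap)
  also have "\<dots> = (\<Sum>f\<in>box ns. \<Sum>h\<in>box ns.
      if f = add_box ns h l then of_real (c (R f)) * of_real (a (R h)) * G else 0)"
    by (intro sum.cong refl)
      (simp add: sum_distrib_left[symmetric] sum_characters3 l G_def)
  also have "\<dots> = (\<Sum>h\<in>box ns. \<Sum>f\<in>box ns.
      if f = add_box ns h l then of_real (c (R f)) * of_real (a (R h)) * G else 0)"
    by (rule sum.swap)
  also have "\<dots> = (\<Sum>h\<in>box ns. of_real (c (R h * g mod X_pow k)) * of_real (a (R h)) * G)"
    using add_box_in_box l by (intro sum.cong refl) (simp add: R_add)
  finally have "T l / G = of_real (\<Sum>h\<in>box ns. c (R h * g mod X_pow k) * a (R h))"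
    using G by (simp add: sum_divide_distrib[symmetric] sum_distrib_right[symmetric])
  moreover have "val (correlation_c k D c a) g = Re (T l / G)"
    using g l(1) by (simp add: correlation_c_def Let_def ns_def[symmetric] R_def[symmetric]
      l_def[symmetric] C_def[symmetric] A_def[symmetric] T_def[symmetric] G_def[symmetric])
  ultimately have "val (correlation_c k D c a) g = (\<Sum>h\<in>box ns. c (R h * g mod X_pow k) * a (R h))"
    by simp
  also have "\<dots> = (\<Sum>n\<in>unit_polys k. c (n * g mod X_pow k) * a n)"
    by (rule sum.reindex_bij_betw[OF bij])
  finally show ?thesis .
qed

theorem fast_matvec_correct:
  fixes a :: "'p::prime_card mod_ring poly \<Rightarrow> real"
  assumes tab: "\<And>f. f \<in> polys_below m \<Longrightarrow> complex_of_real (tab f) = walsh_phi CARD('p) \<alpha> (nu m f)"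
    and k: "1 \<le> k" "k \<le> m" and D: "\<And>j. 1 \<le> j \<Longrightarrow> j \<le> k \<Longrightarrow> unit_group_decomposition j (D j)"
    and g: "g \<in> unit_polys k"
  shows "complex_of_real (val (fast_matvec_c tab m D k a) g) =
           (\<Sum>n\<in>polys_below k. Omega \<alpha> k g n * complex_of_real (a n))"
proof -
  have tab_level: "complex_of_real (tab (X_pow (m - j) * f)) = walsh_phi CARD('p) \<alpha> (nu j f)"
    if "f \<in> polys_below j" "j \<le> m" for f j
    using tab[OF shift_in_polys_below[OF that(2,1)]] nu_shift[OF that(2), of f] by simp
  have g0: "coeff g 0 \<noteq> 0" using g by (simp add: unit_polys_def)
  have block: "complex_of_real (val (correlation_c j (D j) (\<lambda>f. tab (X_pow (m - j) * f))
        (\<lambda>f. a (X_pow (k - j) * f))) (g mod X_pow j)) =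
      (\<Sum>n\<in>unit_polys j. Omega \<alpha> k g (X_pow (k - j) * n) * complex_of_real (a (X_pow (k - j) * n)))"
    if j: "j \<in> {1..k}" for j
  proof -
    have j': "1 \<le> j" "j \<le> k" "j \<le> m" using j k by auto
    have "complex_of_real (tab (X_pow (m - j) * (n * (g mod X_pow j) mod X_pow j))) =
        Omega \<alpha> k g (X_pow (k - j) * n)" for n
    proof -
      have "complex_of_real (tab (X_pow (m - j) * (n * (g mod X_pow j) mod X_pow j))) =
          walsh_phi CARD('p) \<alpha> (nu j (n * g))"
        using tab_level[OF mod_X_pow_in_polys_below j'(3)] by (simp add: mod_mult_right_eq nu_mod)
      also have "nu j (n * g) = nu k (X_pow (k - j) * n * g)"
        using nu_shift[OF j'(2), of "n * g"] by (simp add: mult.assoc)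
      finally show ?thesis by (simp add: Omega_def)
    qed
    then show ?thesis
      using correlation_c_correct[OF j'(1) D[OF j'(1,2)] mod_in_unit_polys[OF j'(1) g0]] by simp
  qed
  have "complex_of_real (tab 0) = Omega \<alpha> k g 0"
    using tab[of 0] by (simp add: polys_below_def Omega_def nu_def)
  then have "complex_of_real (val (fast_matvec_c tab m D k a) g) =
      Omega \<alpha> k g 0 * of_real (a 0) +
      (\<Sum>j=1..k. of_real (val (correlation_c j (D j) (\<lambda>f. tab (X_pow (m - j) * f))
        (\<lambda>f. a (X_pow (k - j) * f))) (g mod X_pow j)))"
    using g by (simp add: fast_matvec_c_def)
  also have "\<dots> = (\<Sum>n\<in>polys_below k. Omega \<alpha> k g n * complex_of_real (a n))"
    unfolding sum_polys_below[of "\<lambda>n. Omega \<alpha> k g n * complex_of_real (a n)"]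
    by (simp add: block)
  finally show ?thesis .
qed

text \<open>
  The quantities \<open>\<eta>_d(n)\<close> and \<open>T_d(h)\<close> of the component-by-component construction, written
  with the Walsh series; \<open>reduced_fast_cbc_correct\<close> below says that the counted program returns a
  vector whose components minimise them.  All values are real, hence the real parts there.
\<close>

definition cbc_eta ::
  "real \<Rightarrow> nat \<Rightarrow> (nat \<Rightarrow> nat) \<Rightarrow> (nat \<Rightarrow> real) \<Rightarrow> (nat \<Rightarrow> 'p::prime_card mod_ring poly) \<Rightarrow>
   nat \<Rightarrow> 'p mod_ring poly \<Rightarrow> complex" where
  "cbc_eta \<alpha> m w \<gamma> g d n =
     (\<Prod>j=1..d. 1 + of_real (\<gamma> j) * walsh_phi CARD('p) \<alpha> (nu m (n * (X_pow (w j) * g j))))"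

definition cbc_T ::
  "real \<Rightarrow> nat \<Rightarrow> (nat \<Rightarrow> nat) \<Rightarrow> (nat \<Rightarrow> real) \<Rightarrow> (nat \<Rightarrow> 'p::prime_card mod_ring poly) \<Rightarrow>
   nat \<Rightarrow> 'p mod_ring poly \<Rightarrow> complex" where
  "cbc_T \<alpha> m w \<gamma> g d h =
     (\<Sum>n\<in>polys_below m.
        walsh_phi CARD('p) \<alpha> (nu m (n * (X_pow (w d) * h))) * cbc_eta \<alpha> m w \<gamma> g (d - 1) n)"

lemma sum_polys_below_split:
  fixes F :: "'p::prime_card mod_ring poly \<Rightarrow> complex"
  assumes "k \<le> m"
  shows "(\<Sum>r\<in>polys_below k. \<Sum>t\<in>polys_below (m - k). F (r + X_pow k * t)) = sum F (polys_below m)"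
proof -
  have mod: "(r + X_pow k * t) mod X_pow k = r" if "r \<in> polys_below k" for r t :: "'p mod_ring poly"
    using that by (simp add: mod_X_pow_id)
  have "(\<Sum>r\<in>polys_below k. \<Sum>t\<in>polys_below (m - k). F (r + X_pow k * t)) =
      (\<Sum>(r, t)\<in>polys_below k \<times> polys_below (m - k). F (r + X_pow k * t))"
    by (simp add: sum.cartesian_product)
  also have "\<dots> = sum F (polys_below m)"
  proof (rule sum.reindex_bij_witness[of _ "\<lambda>n. (n mod X_pow k, n div X_pow k)" "\<lambda>(r, t). r + X_pow k * t"])
    fix x :: "'p mod_ring poly \<times> 'p mod_ring poly"
    assume "x \<in> polys_below k \<times> polys_below (m - k)"
    then obtain r t where x: "x = (r, t)" "r \<in> polys_below k" "t \<in> polys_below (m - k)" by auto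
    have div: "(r + X_pow k * t) div X_pow k = t"
    proof -
      have "(r + X_pow k * t) = X_pow k * ((r + X_pow k * t) div X_pow k) + r"
        using mod[OF x(2), of t] by (metis mult_div_mod_eq)
      then show ?thesis by (simp add: add.commute)
    qed
    show "((case x of (r, t) \<Rightarrow> r + X_pow k * t) mod X_pow k,
        (case x of (r, t) \<Rightarrow> r + X_pow k * t) div X_pow k) = x"
      using x mod div by simp
    show "(case x of (r, t) \<Rightarrow> r + X_pow k * t) \<in> polys_below m"
      using x assms by (auto simp: polys_below_iff_coeff coeff_monom_mult)
    show "F (case x of (r, t) \<Rightarrow> r + X_pow k * t) = (case x of (r, t) \<Rightarrow> F (r + X_pow k * t))"
      using x by simp
  next
    fix n :: "'p mod_ring poly" assume n: "n \<in> polys_below m"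
    have "n div X_pow k \<in> polys_below (m - k)"
    proof -
      have "coeff (n div X_pow k) i = 0" if "i \<ge> m - k" for i
      proof -
        have "coeff n (i + k) = coeff (X_pow k * (n div X_pow k) + n mod X_pow k) (i + k)" by simp
        also have "\<dots> = coeff (n div X_pow k) i"
          using mod_X_pow_in_polys_below[of n k]
          by (simp only: coeff_add coeff_monom_mult polys_below_iff_coeff) simp
        finally show ?thesis using n that by (simp add: polys_below_iff_coeff)
      qed
      then show ?thesis by (simp add: polys_below_iff_coeff)
    qed
    then show "(n mod X_pow k, n div X_pow k) \<in> polys_below k \<times> polys_below (m - k)"
      by (simp add: mod_X_pow_in_polys_below)
    show "(case (n mod X_pow k, n div X_pow k) of (r, t) \<Rightarrow> r + X_pow k * t) = n"
      by (simp add: add.commute)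
  qed
  finally show ?thesis .
qed

context
  fixes \<alpha> :: real and m s :: nat and w :: "nat \<Rightarrow> nat" and \<gamma> :: "nat \<Rightarrow> real"
    and D :: "nat \<Rightarrow> ('p::prime_card mod_ring poly \<times> nat) list" and tab :: "'p mod_ring poly \<Rightarrow> real"
  assumes tab: "\<And>f. f \<in> polys_below m \<Longrightarrow> complex_of_real (tab f) = walsh_phi CARD('p) \<alpha> (nu m f)"
    and D: "\<And>j. 1 \<le> j \<Longrightarrow> j \<le> m \<Longrightarrow> unit_group_decomposition j (D j)"
begin

lemma factor_c_correct:
  "complex_of_real (val (factor_c tab m v c g n)) =
     1 + of_real c * walsh_phi CARD('p) \<alpha> (nu m (n * (X_pow v * g)))"
  by (simp add: factor_c_def tab mod_X_pow_in_polys_below nu_mod)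

lemma matvec_folded:
  fixes \<eta> :: "'p mod_ring poly \<Rightarrow> real"
  assumes v: "v < m" and h: "h \<in> unit_polys (m - v)"
  shows "complex_of_real (val (fast_matvec_c tab m D (m - v) (\<lambda>r\<in>polys_below (m - v).
        \<Sum>t\<in>polys_below v. \<eta> (r + X_pow (m - v) * t))) h) =
    (\<Sum>n\<in>polys_below m. walsh_phi CARD('p) \<alpha> (nu m (n * (X_pow v * h))) * of_real (\<eta> n))"
proof -
  let ?k = "m - v"
  have "complex_of_real (val (fast_matvec_c tab m D ?k (\<lambda>r\<in>polys_below ?k.
        \<Sum>t\<in>polys_below v. \<eta> (r + X_pow ?k * t))) h) =
      (\<Sum>r\<in>polys_below ?k. \<Sum>t\<in>polys_below v. Omega \<alpha> ?k h r * of_real (\<eta> (r + X_pow ?k * t)))"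
    using v h D by (subst fast_matvec_correct[OF tab]) (auto simp: sum_distrib_left)
  also have "\<dots> = (\<Sum>r\<in>polys_below ?k. \<Sum>t\<in>polys_below (m - ?k).
      walsh_phi CARD('p) \<alpha> (nu m ((r + X_pow ?k * t) * (X_pow v * h))) * of_real (\<eta> (r + X_pow ?k * t)))"
  proof (intro sum.cong refl)
    show "polys_below v = polys_below (m - ?k)" using v by simp
    fix r t :: "'p mod_ring poly" assume r: "r \<in> polys_below ?k"
    have "nu m ((r + X_pow ?k * t) * (X_pow v * h)) = nu ?k ((r + X_pow ?k * t) * h)"
      using nu_shift[of ?k m "(r + X_pow ?k * t) * h"] v by (simp add: mult_ac)
    also have "\<dots> = nu ?k (r * h)"
    proof -
      have "(r + X_pow ?k * t) * h mod X_pow ?k = r * h mod X_pow ?k"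
        by (metis mod_mult_left_eq mod_mult_self2)
      then show ?thesis by (metis nu_mod)
    qed
    finally show "Omega \<alpha> ?k h r * of_real (\<eta> (r + X_pow ?k * t)) =
      walsh_phi CARD('p) \<alpha> (nu m ((r + X_pow ?k * t) * (X_pow v * h))) * of_real (\<eta> (r + X_pow ?k * t))"
      by (simp add: Omega_def)
  qed
  also have "\<dots> = (\<Sum>n\<in>polys_below m. walsh_phi CARD('p) \<alpha> (nu m (n * (X_pow v * h))) * of_real (\<eta> n))"
    by (rule sum_polys_below_split) simp
  finally show ?thesis .
qed

lemma cbc_loop_c_correct:
  assumes "\<And>d. 2 \<le> d \<Longrightarrow> d \<le> r + 1 \<Longrightarrow> w d < m"
  shows "case val (cbc_loop_c tab m w \<gamma> D r) of (g, \<eta>) \<Rightarrow>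
     (\<forall>n\<in>polys_below m. complex_of_real (\<eta> n) = cbc_eta \<alpha> m w \<gamma> g (r + 1) n) \<and>
     g 1 = 1 \<and>
     (\<forall>d\<in>{2..r + 1}. g d \<in> unit_polys (m - w d) \<and>
        (\<forall>h\<in>unit_polys (m - w d). Re (cbc_T \<alpha> m w \<gamma> g d (g d)) \<le> Re (cbc_T \<alpha> m w \<gamma> g d h))) \<and>
     (\<forall>d>r + 1. g d = 1)"
  using assms
proof (induction r)
  case 0
  show ?case by (simp add: cbc_eta_def factor_c_correct)
next
  case (Suc r)
  obtain g \<eta> where st: "val (cbc_loop_c tab m w \<gamma> D r) = (g, \<eta>)" by force
  from Suc have IH:
    "\<And>n. n \<in> polys_below m \<Longrightarrow> complex_of_real (\<eta> n) = cbc_eta \<alpha> m w \<gamma> g (r + 1) n" "g 1 = 1"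
    "\<And>d. d \<in> {2..r + 1} \<Longrightarrow> g d \<in> unit_polys (m - w d)"
    "\<And>d h. d \<in> {2..r + 1} \<Longrightarrow> h \<in> unit_polys (m - w d) \<Longrightarrow>
       Re (cbc_T \<alpha> m w \<gamma> g d (g d)) \<le> Re (cbc_T \<alpha> m w \<gamma> g d h)"
    "\<And>d. d > r + 1 \<Longrightarrow> g d = 1"
    by (simp_all add: st)
  define e where "e = r + 2"
  have we: "w e < m" using Suc.prems[of e] by (simp add: e_def)
  define T where "T = val (fast_matvec_c tab m D (m - w e) (\<lambda>r\<in>polys_below (m - w e).
        \<Sum>t\<in>polys_below (w e). \<eta> (r + X_pow (m - w e) * t)))"
  define ge where "ge = arg_min_on T (unit_polys (m - w e))"
  define g' where "g' = g(e := ge)"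
  define \<eta>' where "\<eta>' = (\<lambda>n\<in>polys_below m. \<eta> n * val (factor_c tab m (w e) (\<gamma> e) ge n))"
  have st': "val (cbc_loop_c tab m w \<gamma> D (Suc r)) = (g', \<eta>')"
    by (simp add: st cbc_step_c_def g'_def \<eta>'_def ge_def T_def e_def)
  have eta_cong: "cbc_eta \<alpha> m w \<gamma> g' d n = cbc_eta \<alpha> m w \<gamma> g d n" if "d \<le> r + 1" for d n
    unfolding cbc_eta_def using that by (intro prod.cong refl) (auto simp: g'_def e_def)
  have T_cong: "cbc_T \<alpha> m w \<gamma> g' d h = cbc_T \<alpha> m w \<gamma> g d h" if "d \<le> e" for d h
    unfolding cbc_T_def using that by (intro sum.cong refl) (simp add: eta_cong e_def)
  have T: "T h = Re (cbc_T \<alpha> m w \<gamma> g e h)" if "h \<in> unit_polys (m - w e)" for h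
  proof -
    have "complex_of_real (T h) = cbc_T \<alpha> m w \<gamma> g e h"
      unfolding T_def matvec_folded[OF we that] cbc_T_def
      by (intro sum.cong refl) (simp add: IH(1) e_def)
    then show ?thesis by (metis Re_complex_of_real)
  qed
  have ne: "unit_polys (m - w e) \<noteq> ({} :: 'p mod_ring poly set)"
  proof -
    have "(1 :: 'p mod_ring poly) \<in> unit_polys (m - w e)"
      using we by (intro one_in_unit_polys) simp
    then show ?thesis by blast
  qed
  have ge: "ge \<in> unit_polys (m - w e)"
    unfolding ge_def by (rule arg_min_if_finite(1)[OF finite_unit_polys ne])
  have min: "T ge \<le> T h" if "h \<in> unit_polys (m - w e)" for h
    unfolding ge_def by (rule arg_min_least[OF finite_unit_polys ne that])
  have "complex_of_real (\<eta>' n) = cbc_eta \<alpha> m w \<gamma> g' (Suc r + 1) n" if n: "n \<in> polys_below m" for n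
  proof -
    have "cbc_eta \<alpha> m w \<gamma> g' (Suc r + 1) n = cbc_eta \<alpha> m w \<gamma> g' (r + 1) n *
        (1 + of_real (\<gamma> e) * walsh_phi CARD('p) \<alpha> (nu m (n * (X_pow (w e) * g' e))))"
      by (simp add: cbc_eta_def e_def)
    then show ?thesis
      unfolding eta_cong[OF order_refl] IH(1)[OF n, symmetric]
      using n by (simp add: \<eta>'_def factor_c_correct g'_def)
  qed
  moreover have "g' 1 = 1" using IH(2) by (simp add: g'_def e_def)
  moreover have "g' d \<in> unit_polys (m - w d) \<and>
      (\<forall>h\<in>unit_polys (m - w d). Re (cbc_T \<alpha> m w \<gamma> g' d (g' d)) \<le> Re (cbc_T \<alpha> m w \<gamma> g' d h))"
    if d: "d \<in> {2..Suc r + 1}" for d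
  proof (cases "d = e")
    case True
    then show ?thesis using ge min T T_cong by (simp add: g'_def)
  next
    case False
    then have "d \<in> {2..r + 1}" "d \<le> e" using d by (auto simp: e_def)
    then show ?thesis using False IH(3,4) T_cong by (simp add: g'_def)
  qed
  moreover have "\<forall>d>Suc r + 1. g' d = 1" using IH(5) by (simp add: g'_def e_def)
  ultimately show ?case unfolding st' by simp
qed

end

theorem reduced_fast_cbc_correct:
  fixes D :: "nat \<Rightarrow> ('p::prime_card mod_ring poly \<times> nat) list" and \<gamma> :: "nat \<Rightarrow> real"
  assumes \<alpha>: "\<alpha> > 1" and w: "mono_on {1..s} w"
    and D: "\<forall>k\<in>{1..m}. unit_group_decomposition k (D k)"
  defines "g \<equiv> val (reduced_fast_cbc \<alpha> m s w \<gamma> D)"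
  shows "g 1 = 1"
    and "d \<in> {2..min s (s_star m s w)} \<Longrightarrow> g d \<in> unit_polys (m - w d)"
    and "d \<in> {2..min s (s_star m s w)} \<Longrightarrow> h \<in> unit_polys (m - w d) \<Longrightarrow>
           Re (cbc_T \<alpha> m w \<gamma> g d (g d)) \<le> Re (cbc_T \<alpha> m w \<gamma> g d h)"
    and "d > max 1 (s_star m s w) \<Longrightarrow> g d = 1"
proof -
  define S where "S = s_star m s w"
  have fin: "finite (insert 0 {j \<in> {1..s}. w j < m})" by simp
  have S_in: "S \<in> insert 0 {j \<in> {1..s}. w j < m}"
    unfolding S_def s_star_def by (rule Max_in[OF fin]) simp
  then have S_le: "S \<le> s" by auto
  have w_less: "w d < m" if "2 \<le> d" "d \<le> min s S - 1 + 1" for d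
  proof -
    have "d \<le> S" "1 \<le> d" using that by auto
    then have "S \<noteq> 0" by auto
    then have "w S < m" "S \<in> {1..s}" using S_in by auto
    moreover have "w d \<le> w S"
      using \<open>d \<le> S\<close> \<open>1 \<le> d\<close> S_le by (intro mono_onD[OF w]) auto
    ultimately show ?thesis by simp
  qed
  define tab where "tab = val (phi_table_c \<alpha> m :: ('p mod_ring poly \<Rightarrow> real) counted)"
  have tab: "complex_of_real (tab f) = walsh_phi CARD('p) \<alpha> (nu m f)" if "f \<in> polys_below m" for f
    unfolding tab_def by (rule phi_table_correct[OF \<alpha> that])
  have D': "unit_group_decomposition j (D j)" if "1 \<le> j" "j \<le> m" for j using D that by simp
  obtain \<eta> where st: "val (cbc_loop_c tab m w \<gamma> D (min s S - 1)) = (g, \<eta>)"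
    by (cases "val (cbc_loop_c tab m w \<gamma> D (min s S - 1))")
      (simp add: g_def reduced_fast_cbc_def tab_def S_def)
  note * = cbc_loop_c_correct[where r = "min s S - 1" and \<gamma> = \<gamma> and w = w, OF tab D' w_less, unfolded st prod.case]
  show "g 1 = 1" using * by simp
  show "d \<in> {2..min s (s_star m s w)} \<Longrightarrow> g d \<in> unit_polys (m - w d)"
    using * by (simp add: S_def)
  show "d \<in> {2..min s (s_star m s w)} \<Longrightarrow> h \<in> unit_polys (m - w d) \<Longrightarrow>
      Re (cbc_T \<alpha> m w \<gamma> g d (g d)) \<le> Re (cbc_T \<alpha> m w \<gamma> g d h)"
    using * by (simp add: S_def)
  show "g d = 1" if "d > max 1 (s_star m s w)"
  proof -
    have "d > min s S - 1 + 1" using that S_le by (auto simp: S_def)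
    then show ?thesis using * by blast
  qed
qed

end

theory Submission
  imports Defs
begin

text \<open>
  One transform of length \<open>n\<close> costs \<open>2 n\<close> times the sum of the prime factors of \<open>n\<close>, and a
  multidimensional transform over a product of cyclic groups of total order \<open>n\<close> costs the same.
  The group of units modulo \<open>x^j\<close> has order \<open>(b - 1) b^(j - 1)\<close>, whose prime factors are at most
  \<open>b\<close>; hence a correlation at level \<open>j\<close> takes \<open>O(j b^j)\<close> operations, and so, by a geometric sum,
  do all levels \<open>j \<le> k\<close> together: \<open>O(k b^k)\<close>.  Adding the \<open>k b^k\<close> operations that combine the
  levels and the \<open>O(b^m)\<close> for folding and updating \<open>\<eta>\<close> gives the cost of one step.
\<close>

section \<open>Operation counts of Fourier transforms and group tables\<close>

lemma ops_simps [simp]: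
  "ops (add_c x1 y1) = 1" "ops (sub_c x2 y2) = 1" "ops (mul_c x3 y3) = 1"
  "ops (div_c x4 y4) = 1" "ops (powr_c x5 y5) = 1" "ops (mulmod_c k f g) = 1"
  "ops (root_of_unity_c \<sigma> n j) = 1" "ops (argmin_c A h) = card A - 1"
  "ops (tabulate_c B F) = (\<Sum>i\<in>B. ops (F i))"
  "ops (sum_c B' G) = (\<Sum>i\<in>B'. ops (G i)) + (card B' - 1)"
  by (simp_all add: add_c_def sub_c_def mul_c_def div_c_def powr_c_def mulmod_c_def argmin_c_def
      root_of_unity_c_def tabulate_c_def sum_c_def)

lemma ops_powers_c:
  assumes "\<And>x y. ops (M x y) = 1"
  shows "ops (powers_c M e x n) = n"
  by (induction n) (simp_all add: assms)

text \<open>Splitting off a prime \<open>p\<close> adds \<open>2 p n\<close> operations, at most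
  \<open>2 B n\<close>, and at least halves the length, so the binary logarithm can stand in for the
  number of levels. For \<open>n = 0\<close> the factor \<open>real n\<close> makes the bound
  0.\<close>

lemma ops_fft_c:
  assumes "\<And>q. prime q \<Longrightarrow> q dvd n \<Longrightarrow> q \<le> B"
  shows "real (ops (fft_c \<sigma> n a)) \<le> 2 * real B * real n * log 2 (real n)"
  using assms
proof (induction \<sigma> n a rule: fft_c.induct)
  case (1 \<sigma> n a)
  show ?case
  proof (cases "n \<le> 1")
    case True
    then have "n = 0 \<or> n = 1" by auto
    then show ?thesis by (auto simp: fft_c.simps)
  next
    case False
    define p where "p = (LEAST p. prime p \<and> p dvd n)"
    define l where "l = n div p"
    have p: "prime p" "p dvd n" using least_prime_factor[of n] False by (auto simp: p_def)
    then have p2: "p \<ge> 2" and n: "n = p * l" by (auto simp: l_def prime_ge_2_nat)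
    have pB: "p \<le> B" using p 1(2) by blast
    have l0: "l > 0" using False n by (cases l) auto
    have "real (ops (fft_c \<sigma> l (\<lambda>i. a (p * i + r)))) \<le> 2 * real B * real l * log 2 (real l)" for r
      by (rule 1(1)[OF False p_def l_def]) (use 1(2) n in auto)
    then have IH: "(\<Sum>r<p. real (ops (fft_c \<sigma> l (\<lambda>i. a (p * i + r))))) \<le> (\<Sum>r<p. 2 * real B * real l * log 2 (real l))"
      by (rule sum_mono)
    have "ops (fft_c \<sigma> n a) = (\<Sum>r<p. ops (fft_c \<sigma> l (\<lambda>i. a (p * i + r)))) + (n + n * (p + (p - 1)))"
      using False by (subst fft_c.simps) (simp add: Let_def p_def[symmetric] l_def[symmetric])
    \<comment> \<open>Each of the \<open>n\<close> roots of unity counts once; each of the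
      \<open>n\<close> outputs takes \<open>p\<close> products and \<open>p - 1\<close>
      additions.\<close>
    also have "n + n * (p + (p - 1)) = 2 * p * n"
      using p2 by (cases p) (auto simp: algebra_simps)
    finally have "real (ops (fft_c \<sigma> n a)) = (\<Sum>r<p. real (ops (fft_c \<sigma> l (\<lambda>i. a (p * i + r))))) + 2 * real p * real n"
      by simp
    also have "\<dots> \<le> 2 * real B * real n * log 2 (real l) + 2 * real B * real n"
      using IH pB by (intro add_mono mult_right_mono) (simp_all add: n mult_ac)
    also have "\<dots> = 2 * real B * real n * (1 + log 2 (real l))" by (simp add: algebra_simps)
    also have "\<dots> \<le> 2 * real B * real n * log 2 (real n)"
    proof (rule mult_left_mono)
      have "1 + log 2 (real l) = log 2 (2 * real l)" using l0 by (simp add: log_mult)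
      also have "\<dots> \<le> log 2 (real n)" using l0 p2 by (simp add: n)
      finally show "1 + log 2 (real l) \<le> log 2 (real n)" .
    qed simp
    finally show ?thesis .
  qed
qed

text \<open>The transforms along the first axis contribute the logarithm of \<open>n\<close>, those
  along the other axes the logarithm of their total order, with the same factor in front. Additivity
  of the logarithm, which rests on positivity of the orders, closes the induction.\<close>

lemma ops_multi_fft_c:
  assumes "\<And>q. prime q \<Longrightarrow> q dvd prod_list ns \<Longrightarrow> q \<le> B" "prod_list ns > 0"
  shows "real (ops (multi_fft_c \<sigma> ns a)) \<le> 2 * real B * real (prod_list ns) * log 2 (real (prod_list ns))"
  using assms
proof (induction ns arbitrary: a)
  case (Cons n ns)
  let ?P = "prod_list ns"
  have pos: "n > 0" "?P > 0" using Cons.prems(2) by auto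
  define G where "G = (\<lambda>i\<in>{..<n}. val (multi_fft_c \<sigma> ns (\<lambda>e. a (i # e))))"
  have "real (ops (multi_fft_c \<sigma> (n # ns) a)) =
      (\<Sum>i<n. real (ops (multi_fft_c \<sigma> ns (\<lambda>e. a (i # e))))) + (\<Sum>e\<in>box ns. real (ops (fft_c \<sigma> n (\<lambda>i. G i e))))"
    by (simp add: G_def)
  also have "\<dots> \<le> (\<Sum>i<n. 2 * real B * real ?P * log 2 (real ?P)) + (\<Sum>e\<in>box ns. 2 * real B * real n * log 2 (real n))"
    using Cons.prems(1) pos by (intro add_mono sum_mono Cons.IH ops_fft_c) auto
  also have "\<dots> = 2 * real B * real (prod_list (n # ns)) * log 2 (real (prod_list (n # ns)))"
    using pos by (simp only: prod_list.Cons of_nat_mult log_mult_pos of_nat_0_less_iff)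
      (simp add: algebra_simps)
  finally show ?case .
qed simp

text \<open>Each order is at least 2, so the nested tables grow at least geometrically. With
  \<open>P\<close> the order of the tail, \<open>n \<le> n P\<close> and
  \<open>4 P \<le> 2 n P\<close> give \<open>n + 4 P + n P \<le> 4 n P\<close>.\<close>

lemma ops_group_table_c:
  assumes "\<forall>(g, n) \<in> set D. n \<ge> 2"
  shows "ops (group_table_c k D) \<le> 4 * prod_list (map snd D)"
  using assms
proof (induction k D rule: group_table_c.induct)
  case (2 k g n D)
  let ?P = "prod_list (map snd D)"
  have n: "n \<ge> 2" using 2(2) by simp
  have "?P \<noteq> 0" using 2(2) by auto
  then have "n * 1 \<le> n * ?P" by (intro mult_le_mono2) linarith
  moreover have "2 * ?P \<le> n * ?P" using n by (intro mult_le_mono1)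
  moreover have "ops (group_table_c k D) \<le> 4 * ?P" using 2 by simp
  moreover have "ops (group_table_c k ((g, n) # D)) = n + ops (group_table_c k D) + n * ?P"
    using card_box[of "n # map snd D"] by (simp add: ops_powers_c)
  moreover have "prod_list (map snd ((g, n) # D)) = n * ?P" by simp
  ultimately show ?case by linarith
qed simp

section \<open>Unit groups and correlations over them\<close>

lemma card_polys_below: "card (polys_below k :: 'p::prime_card mod_ring poly set) = CARD('p) ^ k"
proof (induction k)
  case (Suc k)
  have "inj_on (\<lambda>(c, f). pCons c f) (UNIV \<times> (polys_below k :: 'p mod_ring poly set))"
    by (auto simp: inj_on_def)
  then show ?case
    unfolding polys_below_Suc by (simp add: card_image card_cartesian_product Suc)
qed simp

lemma card_unit_polys:
  "card (unit_polys (Suc k) :: 'p::prime_card mod_ring poly set) = (CARD('p) - 1) * CARD('p) ^ k"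
proof -
  have "unit_polys (Suc k) = (\<lambda>(c, f). pCons c f) ` ((UNIV - {0}) \<times> (polys_below k :: 'p mod_ring poly set))"
    by (auto simp: unit_polys_def polys_below_Suc)
  moreover have "inj_on (\<lambda>(c, f). pCons c f) ((UNIV - {0}) \<times> (polys_below k :: 'p mod_ring poly set))"
    by (auto simp: inj_on_def)
  ultimately show ?thesis
    by (simp add: card_image card_cartesian_product card_polys_below card_Diff_singleton)
qed

lemma card_unit_polys_le: "card (unit_polys k :: 'p::prime_card mod_ring poly set) \<le> CARD('p) ^ k"
proof -
  have "unit_polys k \<subseteq> (polys_below k :: 'p mod_ring poly set)"
    by (auto simp: unit_polys_def)
  then show ?thesis
    using card_mono[OF finite_polys_below] card_polys_below by metis
qed

text \<open>This supplies the bound \<open>B = CARD('p)\<close> for the transforms, so that the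
  constants depend on the fixed base only.\<close>

lemma prime_dvd_card_unit_polys:
  assumes "k \<ge> 1" "prime q" "q dvd card (unit_polys k :: 'p::prime_card mod_ring poly set)"
  shows "q \<le> CARD('p)"
proof -
  obtain i where "k = Suc i" using assms(1) by (cases k) auto
  then have "q dvd CARD('p) - 1 \<or> q dvd CARD('p) ^ i"
    using assms(2,3) by (simp add: card_unit_polys prime_dvd_mult_iff)
  then have "q dvd CARD('p) - 1 \<or> q dvd CARD('p)"
    using assms(2) prime_dvd_power by blast
  then show ?thesis
    using CARD_ge_2[where 'p = 'p] by (auto dest!: dvd_imp_le)
qed

text \<open>With \<open>N\<close> units, the three transforms cost at most
  \<open>2 b N log 2 N\<close> each, where \<open>log 2 N \<le> k b\<close>. The remaining
  \<open>6 N\<close> operations are absorbed through \<open>1 \<le> b^2 k\<close>, whence 12 = 6 +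
  6.\<close>

lemma ops_correlation_c:
  fixes D :: "('p::prime_card mod_ring poly \<times> nat) list"
  assumes k: "k \<ge> 1" and D: "unit_group_decomposition k D"
  shows "real (ops (correlation_c k D c a)) \<le> 12 * real CARD('p) ^ 2 * real k * real CARD('p) ^ k"
proof -
  let ?b = "CARD('p)"
  define ns where "ns = map snd D"
  define N where "N = prod_list ns"
  have b2: "?b \<ge> 2" by (rule CARD_ge_2)
  have NU: "N = card (unit_polys k :: 'p mod_ring poly set)"
    using D unfolding unit_group_decomposition_def N_def ns_def card_box[symmetric]
    by (blast intro: bij_betw_same_card)
  have "(1 :: 'p mod_ring poly) \<in> unit_polys k" using k by (rule one_in_unit_polys)
  then have N0: "N > 0" unfolding NU by (auto simp: card_gt_0_iff)
  have Nb: "real N \<le> real ?b ^ k"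
    using card_unit_polys_le[of k, where 'p = 'p] unfolding NU by (metis of_nat_le_iff of_nat_power)
  have "log 2 (real N) \<le> log 2 (real ?b ^ k)" using N0 Nb by simp
  also have "\<dots> = real k * log 2 (real ?b)" using b2 by (simp add: log_nat_power)
  \<comment> \<open>A crude estimate suffices since \<open>b\<close> is fixed:
    \<open>b \<le> 2 ^ b\<close>.\<close>
  also have "\<dots> \<le> real k * real ?b"
  proof -
    have "real ?b \<le> 2 ^ ?b" by (metis less_exp less_imp_le of_nat_le_iff of_nat_numeral of_nat_power)
    then have "log 2 (real ?b) \<le> real ?b"
      using b2 by (simp add: log_le_iff powr_realpow)
    then show ?thesis by (simp add: mult_left_mono)
  qed
  finally have log: "log 2 (real N) \<le> real k * real ?b" .
  define M where "M = 2 * real ?b * real N * log 2 (real N)"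
  have fft: "real (ops (multi_fft_c \<sigma> ns f)) \<le> M" for \<sigma> f
    unfolding M_def N_def
  proof (rule ops_multi_fft_c)
    show "prod_list ns > 0" using N0 by (simp add: N_def)
    show "q \<le> ?b" if "prime q" "q dvd prod_list ns" for q
      using prime_dvd_card_unit_polys[OF k, of q, where 'p = 'p] that NU by (simp add: N_def)
  qed
  have M: "M \<le> 2 * real ?b * real N * (real k * real ?b)"
    unfolding M_def using log by (intro mult_left_mono) auto
  have "ops (group_table_c k D) \<le> 4 * N"
    unfolding N_def ns_def by (rule ops_group_table_c) (use D in \<open>auto simp: unit_group_decomposition_def\<close>)
  then have "real (ops (group_table_c k D)) \<le> 4 * real N" by linarith
  \<comment> \<open>The count of a bind involves the value of its first part; naming the
    intermediate arrays lets the total unfold into separate counts.\<close>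
  moreover define R where "R = val (group_table_c k D)"
  define f1 f2 f3 where "f1 = (\<lambda>e. complex_of_real (c (R e)))" and "f2 = (\<lambda>e. complex_of_real (a (R e)))"
    and "f3 = (\<lambda>e\<in>box ns. val (multi_fft_c 1 ns f1) e * val (multi_fft_c (-1) ns f2) e)"
  have "ops (correlation_c k D c a) = ops (group_table_c k D) + ops (multi_fft_c 1 ns f1) +
      ops (multi_fft_c (-1) ns f2) + ops (multi_fft_c (-1) ns f3) + 2 * N"
    by (simp add: correlation_c_def Let_def flip: ns_def N_def R_def f1_def f2_def f3_def)
  \<comment> \<open>The \<open>6 N\<close> consists of \<open>4 N\<close> for the group table,
    \<open>N\<close> for the pointwise products and \<open>N\<close> for the divisions by the group
    order.\<close>
  ultimately have "real (ops (correlation_c k D c a)) \<le> 6 * real N + 3 * M"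
    using fft[of 1 f1] fft[of "-1" f2] fft[of "-1" f3] by linarith
  also have "\<dots> \<le> 6 * real N * 1 + 6 * real N * (real ?b ^ 2 * real k)"
    using M by (simp add: algebra_simps power2_eq_square)
  also have "\<dots> \<le> 6 * real N * (real ?b ^ 2 * real k) + 6 * real N * (real ?b ^ 2 * real k)"
  proof (intro add_mono mult_left_mono order_refl)
    have "1 * 1 \<le> real ?b ^ 2 * real k" using b2 k by (intro mult_mono) (auto simp: one_le_power)
    then show "1 \<le> real ?b ^ 2 * real k" by simp
  qed auto
  also have "\<dots> = 12 * real ?b ^ 2 * real k * real N" by simp
  also have "\<dots> \<le> 12 * real ?b ^ 2 * real k * real ?b ^ k"
    using Nb by (intro mult_left_mono) auto
  finally show ?thesis .
qed

section \<open>The matrix-vector product\<close>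

lemma sum_powers_le:
  assumes "(2::real) \<le> x"
  shows "(\<Sum>j=1..k. x ^ j) \<le> 2 * x ^ k"
proof (induction k)
  case (Suc k)
  have "2 * x ^ k \<le> x ^ Suc k" using assms by (simp add: mult_right_mono)
  then show ?case using Suc by simp
qed simp

text \<open>Bounding the factor \<open>j\<close> of level \<open>j\<close> by \<open>k\<close>
  leaves a geometric sum, at most twice its last term: hence 24 from the correlations. The product
  for \<open>n = 0\<close> and the combination of the levels account for 1 more each.\<close>

lemma ops_fast_matvec_c:
  fixes D :: "nat \<Rightarrow> ('p::prime_card mod_ring poly \<times> nat) list"
  assumes k: "k \<ge> 1" and D: "\<And>j. 1 \<le> j \<Longrightarrow> j \<le> k \<Longrightarrow> unit_group_decomposition j (D j)"
  shows "real (ops (fast_matvec_c tab m D k a)) \<le> 26 * real CARD('p) ^ 2 * real k * real CARD('p) ^ k"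
proof -
  let ?b = "CARD('p)"
  let ?X = "real ?b ^ 2 * real k * real ?b ^ k"
  have b2: "real ?b \<ge> 2" using CARD_ge_2[where 'p = 'p] by linarith
  have bb: "real ?b ^ 2 \<ge> 1" "real ?b ^ k \<ge> 1" using b2 by (simp_all add: one_le_power)
  have "(\<Sum>j=1..k. real (ops (correlation_c j (D j) (\<lambda>f. tab (X_pow (m - j) * f)) (\<lambda>f. a (X_pow (k - j) * f))))) \<le>
      (\<Sum>j=1..k. 12 * real ?b ^ 2 * real k * real ?b ^ j)"
  proof (rule sum_mono)
    fix j assume j: "j \<in> {1..k}"
    then have "12 * real ?b ^ 2 * real j * real ?b ^ j \<le> 12 * real ?b ^ 2 * real k * real ?b ^ j"
      by (intro mult_right_mono mult_left_mono) auto
    then show "real (ops (correlation_c j (D j) (\<lambda>f. tab (X_pow (m - j) * f)) (\<lambda>f. a (X_pow (k - j) * f)))) \<le>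
        12 * real ?b ^ 2 * real k * real ?b ^ j"
      using ops_correlation_c[of j "D j"] D j by (meson atLeastAtMost_iff order_trans)
  qed
  also have "\<dots> = 12 * real ?b ^ 2 * real k * (\<Sum>j=1..k. real ?b ^ j)"
    by (simp add: sum_distrib_left)
  also have "\<dots> \<le> 12 * real ?b ^ 2 * real k * (2 * real ?b ^ k)"
    using sum_powers_le[OF b2, of k] by (intro mult_left_mono) auto
  finally have corr: "(\<Sum>j=1..k. real (ops (correlation_c j (D j) (\<lambda>f. tab (X_pow (m - j) * f))
      (\<lambda>f. a (X_pow (k - j) * f))))) \<le> 24 * ?X" by simp
  have "1 * 1 * 1 \<le> ?X" using bb k by (intro mult_mono) auto
  then have one: "1 \<le> ?X" by simp
  have "real (card (unit_polys k :: 'p mod_ring poly set)) \<le> real ?b ^ k"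
    using card_unit_polys_le[of k, where 'p = 'p] by (metis of_nat_le_iff of_nat_power)
  then have "real (card (unit_polys k :: 'p mod_ring poly set)) * real k \<le> real ?b ^ k * real k"
    by (rule mult_right_mono) simp
  also have "\<dots> = 1 * real k * real ?b ^ k" by simp
  also have "\<dots> \<le> ?X" using bb by (intro mult_right_mono) auto
  finally have comb: "real (card (unit_polys k :: 'p mod_ring poly set)) * real k \<le> ?X" .
  \<comment> \<open>Per \<open>g\<close> there are \<open>k - 1\<close> additions over the levels
    and one for the zero column; they make \<open>k\<close> because \<open>k \<ge> 1\<close> rules
    out truncated subtraction.\<close>
  have "real (ops (fast_matvec_c tab m D k a)) =
      (\<Sum>j=1..k. real (ops (correlation_c j (D j) (\<lambda>f. tab (X_pow (m - j) * f)) (\<lambda>f. a (X_pow (k - j) * f))))) +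
      1 + real (card (unit_polys k :: 'p mod_ring poly set)) * real k"
    using k by (simp add: fast_matvec_c_def)
  then show ?thesis using corr one comb by simp
qed

section \<open>Construction steps, loop and precomputation\<close>

lemma ops_factor_c: "ops (factor_c tab m w \<gamma> g n) = 3"
  by (simp add: factor_c_def)

text \<open>The 5 is 1 for folding plus 4 for updating \<open>\<eta>\<close> (three operations in
  \<open>factor_c\<close> and one product); the 27 is 26 for the matrix-vector product plus 1 for
  the search of the minimum.\<close>

lemma ops_cbc_step_c:
  fixes D :: "nat \<Rightarrow> ('p::prime_card mod_ring poly \<times> nat) list"
  assumes w: "w < m" and D: "\<And>j. 1 \<le> j \<Longrightarrow> j \<le> m \<Longrightarrow> unit_group_decomposition j (D j)"
  shows "real (ops (cbc_step_c tab m w \<gamma> D \<eta>)) \<le>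
    5 * real CARD('p) ^ m + 27 * real CARD('p) ^ 2 * (real (m - w) ^ 2 * real CARD('p) ^ (m - w))"
proof -
  let ?b = "CARD('p)"
  let ?k = "m - w"
  let ?X = "real ?b ^ 2 * (real ?k ^ 2 * real ?b ^ ?k)"
  define \<eta>' where "\<eta>' = (\<lambda>r\<in>polys_below ?k. \<Sum>t\<in>polys_below w. \<eta> (r + X_pow ?k * t))"
  have b2: "real ?b \<ge> 2" using CARD_ge_2[where 'p = 'p] by linarith
  have bb: "real ?b ^ 2 \<ge> 1" using b2 by (simp add: one_le_power)
  have k: "?k \<ge> 1" using w by simp
  have k2: "real ?k \<le> real ?k ^ 2" "1 \<le> real ?k ^ 2"
    using k self_le_power[of "real ?k" 2] one_le_power[of "real ?k" 2] by simp_all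
  \<comment> \<open>Each of the \<open>b ^ k\<close> entries of the folded vector takes
    \<open>b ^ w - 1\<close> additions.\<close>
  have "?b ^ ?k * (?b ^ w - 1) \<le> ?b ^ ?k * ?b ^ w" by (intro mult_le_mono2) simp
  also have "\<dots> = ?b ^ m" using w by (simp flip: power_add)
  finally have fold: "real (?b ^ ?k * (?b ^ w - 1)) \<le> real ?b ^ m"
    by (metis of_nat_le_iff of_nat_power)
  have "real (ops (fast_matvec_c tab m D ?k \<eta>')) \<le> 26 * real ?b ^ 2 * real ?k * real ?b ^ ?k"
    using k D by (intro ops_fast_matvec_c) auto
  \<comment> \<open>The matrix-vector bound is linear in \<open>k\<close>; the second factor
    \<open>k\<close> is given away here to reach the shape of the claimed bound.\<close>
  also have "\<dots> \<le> 26 * real ?b ^ 2 * real ?k ^ 2 * real ?b ^ ?k"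
    using k2 by (intro mult_right_mono mult_left_mono) auto
  finally have matvec: "real (ops (fast_matvec_c tab m D ?k \<eta>')) \<le> 26 * ?X" by simp
  have "real (card (unit_polys ?k :: 'p mod_ring poly set) - 1) \<le> 1 * (1 * real ?b ^ ?k)"
    using card_unit_polys_le[of ?k, where 'p = 'p]
    by (metis diff_le_self le_trans mult_1 of_nat_le_iff of_nat_power)
  also have "\<dots> \<le> ?X" using bb k2 by (intro mult_mono) auto
  finally have argmin: "real (card (unit_polys ?k :: 'p mod_ring poly set) - 1) \<le> ?X" .
  have "ops (cbc_step_c tab m w \<gamma> D \<eta>) = ?b ^ ?k * (?b ^ w - 1) + ops (fast_matvec_c tab m D ?k \<eta>') +
      (card (unit_polys ?k :: 'p mod_ring poly set) - 1) + 4 * ?b ^ m"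
    by (simp add: cbc_step_c_def \<eta>'_def ops_factor_c card_polys_below)
  then have "real (ops (cbc_step_c tab m w \<gamma> D \<eta>)) = real (?b ^ ?k * (?b ^ w - 1)) +
      real (ops (fast_matvec_c tab m D ?k \<eta>')) +
      real (card (unit_polys ?k :: 'p mod_ring poly set) - 1) + 4 * real ?b ^ m"
    by (simp only: of_nat_add of_nat_mult of_nat_power of_nat_numeral)
  then show ?thesis using fold matvec argmin by linarith
qed

text \<open>The step bound is uniform in \<open>\<eta>\<close>, so the counts add up whatever arrays
  the earlier steps produce. The term \<open>3 b^m\<close> pays for the initial array of component
  1, and the steps treat the components from 2 on.\<close>

lemma ops_cbc_loop_c:
  fixes D :: "nat \<Rightarrow> ('p::prime_card mod_ring poly \<times> nat) list"
  assumes D: "\<And>j. 1 \<le> j \<Longrightarrow> j \<le> m \<Longrightarrow> unit_group_decomposition j (D j)"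
    and w: "\<And>d. 2 \<le> d \<Longrightarrow> d \<le> r + 1 \<Longrightarrow> w d < m"
  shows "real (ops (cbc_loop_c tab m w \<gamma> D r)) \<le>
    3 * real CARD('p) ^ m + (\<Sum>d=2..r + 1.
      5 * real CARD('p) ^ m + 27 * real CARD('p) ^ 2 * (real (m - w d) ^ 2 * real CARD('p) ^ (m - w d)))"
  using w
proof (induction r)
  case 0
  show ?case by (simp add: ops_factor_c card_polys_below)
next
  case (Suc r)
  obtain g \<eta> where st: "val (cbc_loop_c tab m w \<gamma> D r) = (g, \<eta>)" by force
  have "ops (cbc_loop_c tab m w \<gamma> D (Suc r)) =
      ops (cbc_loop_c tab m w \<gamma> D r) + ops (cbc_step_c tab m (w (r + 2)) (\<gamma> (r + 2)) D \<eta>)"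
    by (simp add: st case_prod_unfold)
  moreover have "real (ops (cbc_step_c tab m (w (r + 2)) (\<gamma> (r + 2)) D \<eta>)) \<le>
      5 * real CARD('p) ^ m + 27 * real CARD('p) ^ 2 * (real (m - w (r + 2)) ^ 2 * real CARD('p) ^ (m - w (r + 2)))"
    using Suc.prems by (intro ops_cbc_step_c D) auto
  ultimately show ?case using Suc by simp
qed

text \<open>There are six scalar operations, \<open>m\<close> powers and at most two operations per
  entry; \<open>m < b^m\<close> gives \<open>6 + m \<le> 7 b^m\<close>.\<close>

lemma ops_phi_table_c:
  "real (ops (phi_table_c \<alpha> m :: ('p::prime_card mod_ring poly \<Rightarrow> real) counted)) \<le> 9 * real CARD('p) ^ m"
proof -
  let ?b = "CARD('p)"
  have "(\<Sum>f\<in>(polys_below m :: 'p mod_ring poly set). if f = 0 then 0 else 2) \<le>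
      (\<Sum>f\<in>(polys_below m :: 'p mod_ring poly set). 2 :: nat)"
    by (rule sum_mono) simp
  also have "\<dots> = 2 * ?b ^ m" by (simp add: card_polys_below)
  finally have tab: "(\<Sum>f\<in>(polys_below m :: 'p mod_ring poly set). if f = 0 then 0 else 2) \<le> 2 * ?b ^ m" .
  have "m < ?b ^ m"
    using CARD_ge_2[where 'p = 'p] by (intro power_gt_expt) simp
  moreover have "ops (phi_table_c \<alpha> m :: ('p mod_ring poly \<Rightarrow> real) counted) =
      6 + m + (\<Sum>f\<in>(polys_below m :: 'p mod_ring poly set). if f = 0 then 0 else 2)"
    by (simp add: phi_table_c_def ops_powers_c if_distrib[of ops] numeral_2_eq_2 cong: if_cong)
  ultimately have "ops (phi_table_c \<alpha> m :: ('p mod_ring poly \<Rightarrow> real) counted) \<le> 9 * ?b ^ m"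
    using tab by linarith
  then show ?thesis by (metis of_nat_le_iff of_nat_mult of_nat_numeral of_nat_power)
qed

section \<open>Total cost of the construction\<close>

lemma less_if_le_s_star:
  assumes w: "mono_on {1..s} w" and d: "1 \<le> d" "d \<le> s_star m s w"
  shows "w d < m"
proof -
  define S where "S = s_star m s w"
  have fin: "finite (insert 0 {j \<in> {1..s}. w j < m})" by simp
  have "S \<in> insert 0 {j \<in> {1..s}. w j < m}"
    unfolding S_def s_star_def by (rule Max_in[OF fin]) simp
  \<comment> \<open>Since \<open>1 \<le> d\<close>, the maximum is not the inserted default 0 but an
    actual index.\<close>
  then have S: "S \<in> {1..s}" "w S < m" using d by (auto simp: S_def)
  have "w d \<le> w S"
    using d S by (intro mono_onD[OF w]) (auto simp: S_def)
  then show ?thesis using S by simp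
qed

theorem theorem4:
  fixes \<alpha> :: real
  assumes "\<alpha> > 1"
  shows "\<exists>C::real. \<forall>(m::nat) (s::nat) (\<gamma> :: nat \<Rightarrow> real) (w :: nat \<Rightarrow> nat)
           (D :: nat \<Rightarrow> ('p::prime_card mod_ring poly \<times> nat) list).
         m \<ge> 1 \<and> s \<ge> 1 \<and> (\<forall>j\<in>{1..s}. \<gamma> j > 0) \<and> mono_on {1..s} w \<and>
         (\<forall>k\<in>{1..m}. unit_group_decomposition k (D k)) \<longrightarrow>
         real (ops (reduced_fast_cbc \<alpha> m s w \<gamma> D)) \<le>
           C * (real CARD('p) ^ m
                + real (min s (s_star m s w)) * real CARD('p) ^ m
                + (\<Sum>d = 1..min s (s_star m s w).
                     real (m - w d) ^ 2 * real CARD('p) ^ (m - w d)))"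
proof (intro exI allI impI)
  fix m s :: nat and \<gamma> :: "nat \<Rightarrow> real" and w :: "nat \<Rightarrow> nat"
    and D :: "nat \<Rightarrow> ('p mod_ring poly \<times> nat) list"
  assume *: "m \<ge> 1 \<and> s \<ge> 1 \<and> (\<forall>j\<in>{1..s}. \<gamma> j > 0) \<and> mono_on {1..s} w \<and>
         (\<forall>k\<in>{1..m}. unit_group_decomposition k (D k))"
  let ?b = "real CARD('p)"
  define S where "S = min s (s_star m s w)"
  define t where "t d = real (m - w d) ^ 2 * ?b ^ (m - w d)" for d
  \<comment> \<open>The 12 is 9 for the kernel table plus 3 for the first array; it also dominates
    the 5 of each step.\<close>
  define C where "C = 12 + 27 * ?b ^ 2"
  define tab where "tab = val (phi_table_c \<alpha> m :: ('p mod_ring poly \<Rightarrow> real) counted)"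
  have C: "12 \<le> C" "5 \<le> C" "27 * ?b ^ 2 \<le> C" by (simp_all add: C_def)
  have t: "t d \<ge> 0" for d by (simp add: t_def)
  \<comment> \<open>For \<open>S = 0\<close> truncated subtraction makes the upper end 1 and the
    range empty: only the table and the first array are computed, and the term \<open>b^m\<close>
    pays for them. Otherwise every step that is run has \<open>m - w d \<ge> 1\<close>.\<close>
  have less: "w d < m" if "2 \<le> d" "d \<le> S - 1 + 1" for d
    using that * by (intro less_if_le_s_star[of s]) (auto simp: S_def)
  have "real (ops (reduced_fast_cbc \<alpha> m s w \<gamma> D)) =
      real (ops (phi_table_c \<alpha> m :: ('p mod_ring poly \<Rightarrow> real) counted)) +
      real (ops (cbc_loop_c tab m w \<gamma> D (S - 1)))"
    by (simp add: reduced_fast_cbc_def tab_def S_def case_prod_unfold)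
  also have "\<dots> \<le> 9 * ?b ^ m + (3 * ?b ^ m + (\<Sum>d=2..S - 1 + 1. 5 * ?b ^ m + 27 * ?b ^ 2 * t d))"
    unfolding t_def using * less by (intro add_mono ops_phi_table_c ops_cbc_loop_c) auto
  \<comment> \<open>The claimed sum includes component 1, for which no search is made; its summand
    is nonnegative.\<close>
  also have "(\<Sum>d=2..S - 1 + 1. 5 * ?b ^ m + 27 * ?b ^ 2 * t d) \<le> (\<Sum>d=1..S. 5 * ?b ^ m + 27 * ?b ^ 2 * t d)"
    using t by (intro sum_mono2) auto
  also have "\<dots> \<le> (\<Sum>d=1..S. C * ?b ^ m + C * t d)"
    using C t by (intro sum_mono add_mono mult_right_mono) auto
  also have "\<dots> = C * (real S * ?b ^ m + (\<Sum>d=1..S. t d))"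
    by (simp add: sum.distrib sum_distrib_left algebra_simps)
  also have "9 * ?b ^ m + (3 * ?b ^ m + C * (real S * ?b ^ m + (\<Sum>d=1..S. t d))) \<le>
      C * ?b ^ m + C * (real S * ?b ^ m + (\<Sum>d=1..S. t d))"
    using mult_right_mono[OF C(1), of "?b ^ m"] by simp
  also have "\<dots> = C * (?b ^ m + real S * ?b ^ m + (\<Sum>d=1..S. t d))"
    by (simp add: algebra_simps)
  \<comment> \<open>The witness left open by \<open>exI\<close> is fixed here; it is an expression
    in \<open>b\<close> alone, hence uniform in all quantified data.\<close>
  finally show "real (ops (reduced_fast_cbc \<alpha> m s w \<gamma> D)) \<le>
      (12 + 27 * ?b ^ 2) * (?b ^ m + real (min s (s_star m s w)) * ?b ^ m
         + (\<Sum>d = 1..min s (s_star m s w). real (m - w d) ^ 2 * ?b ^ (m - w d)))"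
    by (simp only: C_def S_def t_def)
qed

end
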